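(* Let $f\in\mathcal{D}'(\mathbb{R}^d)$, $\mathbf{x}_0\in\mathbb{R}^d$, and let $\gamma$ be a constant. If $$\lim_{n\to\infty}\langle f(\mathbf{x}_0+\mathbf{x}),\phi_n(\mathbf{x})\rangle=\gamma$$ for all delta sequences $\{\phi_n\}_{n=1}^\infty$ of positive normalized test functions, then the following two conditions hold: (1) There is an $r^*>0$ such that $f|_{B_{r^*}(\mathbf{x}_0)}\in L^\infty(B_{r^*}(\mathbf{x}_0))$. (2) $\displaystyle\lim_{r\to0}\left\|f|_{B_r(\mathbf{x}_0)}-\gamma\chi_{B_r(\mathbf{x}_0)}\right\|_\infty=0$. Conversely, if (1) and (2) are satisfied (with $r^*$ as in (1)), then $\lim_{n\to\infty}\langle f(\mathbf{x}_0+\mathbf{x}),\phi_n(\mathbf{x})\rangle=\gamma$ for all delta sequences $\{\phi_n\}_{n=1}^\infty$ of positive normalized test functions with supports contained in $B_{r^*}(\mathbf{0})$.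
   Context: $\mathcal{D}(\mathbb{R}^d)$ is the space of compactly supported $C^\infty$ functions (test functions), $\mathcal{D}'(\mathbb{R}^d)$ its dual (distributions). A test function $\phi$ is positive if $\phi\ge0$ everywhere and normalized if $\int_{\mathbb{R}^d}\phi=1$. A sequence $\{\phi_n\}$ of test functions is a delta sequence if $\phi_n\to\delta$ in $\mathcal{D}'(\mathbb{R}^d)$, i.e. $\lim_{n\to\infty}\int_{\mathbb{R}^d}\phi_n(\mathbf{x})\psi(\mathbf{x})\,\mathrm{d}\mathbf{x}=\psi(\mathbf{0})$ for all $\psi\in\mathcal{D}(\mathbb{R}^d)$. Also $\langle f(\mathbf{x}_0+\mathbf{x}),\phi(\mathbf{x})\rangle=\langle f(\mathbf{y}),\phi(\mathbf{y}-\mathbf{x}_0)\rangle$. $B_r(\mathbf{a})$ is the open ball of radius $r$ centered at $\mathbf{a}$ and $\chi_{B_r(\mathbf{x}_0)}$ is its characteristic function. The notation $f|_{B}\in L^\infty(B)$ means that the restriction of the distribution $f$ to the open set $B$ is a regular distribution given by a function in $L^\infty(B)$ (again denoted $f$), i.e. $\langle f,\phi\rangle=\int_B f\phi$ for all test functions $\phi$ with compact support in $B$; in (2), $\|\cdot\|_\infty$ is the $L^\infty(B_r(\mathbf{x}_0))$ norm, for $0<r\le r^*$. *)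

theory Defs
  imports "HOL-Probability.Essential_Supremum" "HOL-Library.Nonpos_Ints"
begin

text \<open>Test functions and distributions are complex valued, and duality pairings are bilinear
  (no complex conjugation).\<close>

definition supp :: "('a::topological_space \<Rightarrow> complex) \<Rightarrow> 'a set"
  where "supp \<phi> = closure {x. \<phi> x \<noteq> 0}"

text \<open>Multi-indices are encoded as lists of coordinate directions.\<close>

primrec iter_partial ::
  "'a::euclidean_space list \<Rightarrow> ('a \<Rightarrow> complex) \<Rightarrow> 'a \<Rightarrow> complex"
  where
    "iter_partial [] \<phi> = \<phi>"
  | "iter_partial (v # vs) \<phi> = (\<lambda>x. frechet_derivative (iter_partial vs \<phi>) (at x) v)"

definition smooth :: "('a::euclidean_space \<Rightarrow> complex) \<Rightarrow> bool"
  where "smooth \<phi> \<longleftrightarrow> (\<forall>vs\<in>lists Basis. \<forall>x. iter_partial vs \<phi> differentiable (at x))"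

definition test_functions :: "('a::euclidean_space \<Rightarrow> complex) set"
  where "test_functions = {\<phi>. smooth \<phi> \<and> compact (supp \<phi>)}"

definition tendsto_test ::
  "(nat \<Rightarrow> 'a::euclidean_space \<Rightarrow> complex) \<Rightarrow> ('a \<Rightarrow> complex) \<Rightarrow> bool"
  where "tendsto_test \<phi> \<psi> \<longleftrightarrow>
    (\<exists>K. compact K \<and> (\<forall>n. supp (\<phi> n) \<subseteq> K)) \<and>
    (\<forall>vs\<in>lists Basis. uniform_limit UNIV (\<lambda>n. iter_partial vs (\<phi> n)) (iter_partial vs \<psi>) sequentially)"

text \<open>A distribution is a functional on all functions of which only the values on test functions
  are meaningful. On the space of test functions, a linear functional is continuous for the
  inductive limit topology iff it is sequentially continuous.\<close>

definition distribution :: "(('a::euclidean_space \<Rightarrow> complex) \<Rightarrow> complex) \<Rightarrow> bool"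
  where "distribution f \<longleftrightarrow>
    (\<forall>\<phi>\<in>test_functions. \<forall>\<psi>\<in>test_functions. f (\<lambda>x. \<phi> x + \<psi> x) = f \<phi> + f \<psi>) \<and>
    (\<forall>c. \<forall>\<phi>\<in>test_functions. f (\<lambda>x. c * \<phi> x) = c * f \<phi>) \<and>
    (\<forall>\<phi> \<psi>. (\<forall>n. \<phi> n \<in> test_functions) \<and> \<psi> \<in> test_functions \<and> tendsto_test \<phi> \<psi>
       \<longrightarrow> (\<lambda>n. f (\<phi> n)) \<longlonglongrightarrow> f \<psi>)"

text \<open>The distribution \<open>f(x\<^sub>0 + x)\<close>.\<close>

definition translate ::
  "'a::euclidean_space \<Rightarrow> (('a \<Rightarrow> complex) \<Rightarrow> complex) \<Rightarrow> ('a \<Rightarrow> complex) \<Rightarrow> complex"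
  where "translate x0 f \<phi> = f (\<lambda>y. \<phi> (y - x0))"

definition positive_fun :: "('a \<Rightarrow> complex) \<Rightarrow> bool"
  where "positive_fun \<phi> \<longleftrightarrow> (\<forall>x. \<phi> x \<in> \<real>\<^sub>\<ge>\<^sub>0)"

definition normalized_fun :: "('a::euclidean_space \<Rightarrow> complex) \<Rightarrow> bool"
  where "normalized_fun \<phi> \<longleftrightarrow> (LINT x|lebesgue. \<phi> x) = 1"

definition delta_sequence :: "(nat \<Rightarrow> 'a::euclidean_space \<Rightarrow> complex) \<Rightarrow> bool"
  where "delta_sequence \<phi> \<longleftrightarrow>
    (\<forall>n. \<phi> n \<in> test_functions) \<and>
    (\<forall>\<psi>\<in>test_functions. (\<lambda>n. LINT x|lebesgue. \<phi> n x * \<psi> x) \<longlonglongrightarrow> \<psi> 0)"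

text \<open>Non-measurable functions have \<open>L\<^sup>\<infinity>\<close> norm \<open>\<infinity>\<close>, by definition of \<open>esssup\<close>.\<close>

definition Linf_norm :: "'a::euclidean_space set \<Rightarrow> ('a \<Rightarrow> complex) \<Rightarrow> ereal"
  where "Linf_norm B g = esssup (lebesgue_on B) (\<lambda>x. ereal (norm (g x)))"

definition Linf :: "'a::euclidean_space set \<Rightarrow> ('a \<Rightarrow> complex) set"
  where "Linf B = {g. g \<in> borel_measurable (lebesgue_on B) \<and> Linf_norm B g < \<infinity>}"

definition represents_on ::
  "('a::euclidean_space \<Rightarrow> complex) \<Rightarrow> (('a \<Rightarrow> complex) \<Rightarrow> complex) \<Rightarrow> 'a set \<Rightarrow> bool"
  where "represents_on g f B \<longleftrightarrow>
    (\<forall>\<phi>\<in>test_functions. supp \<phi> \<subseteq> B \<longrightarrow> f \<phi> = (LINT x|lebesgue_on B. g x * \<phi> x))"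

text \<open>\<open>f|\<^sub>B \<in> L\<^sup>\<infinity>(B)\<close>\<close>

definition restricts_to_Linf ::
  "(('a::euclidean_space \<Rightarrow> complex) \<Rightarrow> complex) \<Rightarrow> 'a set \<Rightarrow> bool"
  where "restricts_to_Linf f B \<longleftrightarrow> (\<exists>g\<in>Linf B. represents_on g f B)"

text \<open>The function \<open>f|\<^sub>B\<close>, determined up to null sets on \<open>B\<close>; arbitrary if
  \<open>f|\<^sub>B\<close> is not in \<open>L\<^sup>\<infinity>(B)\<close>.\<close>

definition restriction ::
  "(('a::euclidean_space \<Rightarrow> complex) \<Rightarrow> complex) \<Rightarrow> 'a set \<Rightarrow> 'a \<Rightarrow> complex"
  where "restriction f B = (SOME g. g \<in> Linf B \<and> represents_on g f B)"

end

theory Submission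
  imports Defs
begin

text \<open>Testing on all delta sequences forces a local bound: for every \<open>\<epsilon> > 0\<close> there is a ball \<open>U\<close> around
  \<open>x\<^sub>0\<close> such that \<open>\<bar>\<langle>f - \<gamma>, u\<rangle>\<bar> \<le> \<epsilon> \<integral> u\<close> for all nonnegative test functions \<open>u\<close> supported in \<open>U\<close>;
  otherwise violators on shrinking balls would form a delta sequence. The bound passes to
  \<open>\<epsilon> \<integral> \<bar>u\<bar>\<close> for real test functions \<open>u\<close>, since \<open>u\<close> is a difference of nonnegative test functions
  whose sum is nearly \<open>\<bar>u\<bar>\<close>. So the functional extends to \<open>L\<^sup>1(U)\<close>, and adding \<open>\<epsilon>\<close> times Lebesgue
  measure turns it into a positive measure, whose Radon--Nikodym density yields the \<open>L\<^sup>\<infinity>\<close>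
  function. Conversely, a smooth cutoff splits each \<open>\<phi>\<^sub>n\<close> into a part near the origin, where \<open>f\<close> is
  almost \<open>\<gamma>\<close>, and a remainder whose mass tends to \<open>0\<close>.\<close>

subsection \<open>Functions of class \<open>C\<^sup>k\<close>\<close>

text \<open>Two obstacles shape the argument. The hypothesis speaks of positive test functions only,
  while duality asks for a bound by the L^1 norm for all of them; the positive and negative parts of
  a test function are in general not smooth, hence the detour through a smooth majorant of the
  modulus. Moreover \<open>restriction f (ball x0 r)\<close> is chosen anew for each r, so nothing
  ties it pointwise to the density that is constructed. Condition (2) is therefore derived for an
  arbitrary representative, directly from the bound on test functions, which requires passing from
  such weak bounds to bounds almost everywhere. The term \<gamma> \<integral> u comes from
  homogeneity: both sides of the bound scale with u, so it is the statement about normalized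
  functions, freed from the normalization. Real and imaginary parts are treated separately; this
  costs a factor 2 in front of \<epsilon>, harmless because \<epsilon> is arbitrary.\<close>

text \<open>The innermost derivative is peeled off, so an induction on the order meets the partial
  derivatives of \<open>u\<close> as functions to which the induction hypothesis applies.
  \<open>Ck n\<close> says that all iterated partials of order below n are differentiable
  everywhere; thus \<open>Ck 1\<close> is plain differentiability. The general codomain serves real
  and complex functions alike.\<close>

primrec Ck :: "nat \<Rightarrow> ('a::euclidean_space \<Rightarrow> 'b::real_normed_vector) \<Rightarrow> bool" where
  "Ck 0 u \<longleftrightarrow> True"
| "Ck (Suc n) u \<longleftrightarrow> (\<forall>x. u differentiable (at x)) \<and>
     (\<forall>b\<in>Basis. Ck n (\<lambda>x. frechet_derivative u (at x) b))"

text \<open>By uniqueness of the derivative, any \<open>D\<close> delivered by the derivative rules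
  can replace \<open>frechet_derivative\<close>. Together with \<open>Ck_Suc_derivative\<close> this
  keeps the closure proofs free of the canonical derivative.\<close>

lemma Ck_SucI:
  assumes "\<And>x. (u has_derivative D x) (at x)" "\<And>b. b \<in> Basis \<Longrightarrow> Ck n (\<lambda>x. D x b)"
  shows "Ck (Suc n) u"
proof -
  have "frechet_derivative u (at x) = D x" for x
    using frechet_derivative_at[OF assms(1)[of x]] by simp
  then show ?thesis
    using assms by (auto simp: differentiable_def)
qed

lemma Ck_Suc_derivative:
  assumes "Ck (Suc n) u"
  shows "\<exists>D. (\<forall>x. (u has_derivative D x) (at x)) \<and> (\<forall>b\<in>Basis. Ck n (\<lambda>x. D x b))"
  using assms by (intro exI[of _ "\<lambda>x. frechet_derivative u (at x)"]) (simp add: frechet_derivative_works[symmetric])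

lemma Ck_SucD: "Ck (Suc n) u \<Longrightarrow> Ck n u"
  by (induction n arbitrary: u) auto

lemma Ck_const: "Ck n (\<lambda>x. c)"
proof (induction n arbitrary: c)
  case (Suc n)
  then show ?case by (intro Ck_SucI[where D="\<lambda>x h. 0"]) auto
qed simp

lemma Ck_linear:
  assumes "bounded_linear L" "Ck n u" shows "Ck n (\<lambda>x. L (u x))"
  using assms(2)
proof (induction n arbitrary: u)
  case (Suc n)
  from Suc.prems obtain D where D: "\<And>x. (u has_derivative D x) (at x)"
    "\<And>b. b \<in> Basis \<Longrightarrow> Ck n (\<lambda>x. D x b)" using Ck_Suc_derivative by blast
  show ?case
  proof (rule Ck_SucI)
    show "((\<lambda>x. L (u x)) has_derivative (\<lambda>h. L (D x h))) (at x)" for x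
      by (rule bounded_linear.has_derivative[OF assms(1) D(1)])
  qed (rule Suc.IH[OF D(2)])
qed simp

lemma Ck_add:
  assumes "Ck n u" "Ck n v" shows "Ck n (\<lambda>x. u x + v x)"
  using assms
proof (induction n arbitrary: u v)
  case (Suc n)
  from Suc.prems(1) obtain D where D: "\<And>x. (u has_derivative D x) (at x)"
    "\<And>b. b \<in> Basis \<Longrightarrow> Ck n (\<lambda>x. D x b)" using Ck_Suc_derivative by blast
  from Suc.prems(2) obtain D' where D': "\<And>x. (v has_derivative D' x) (at x)"
    "\<And>b. b \<in> Basis \<Longrightarrow> Ck n (\<lambda>x. D' x b)" using Ck_Suc_derivative by blast
  show ?case
    by (rule Ck_SucI[OF has_derivative_add[OF D(1) D'(1)] Suc.IH[OF D(2) D'(2)]])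
qed simp

lemma Ck_mult:
  fixes u v :: "'a::euclidean_space \<Rightarrow> 'b::real_normed_algebra"
  assumes "Ck n u" "Ck n v" shows "Ck n (\<lambda>x. u x * v x)"
  using assms
proof (induction n arbitrary: u v)
  case (Suc n)
  from Suc.prems(1) obtain D where D: "\<And>x. (u has_derivative D x) (at x)"
    "\<And>b. b \<in> Basis \<Longrightarrow> Ck n (\<lambda>x. D x b)" using Ck_Suc_derivative by blast
  from Suc.prems(2) obtain D' where D': "\<And>x. (v has_derivative D' x) (at x)"
    "\<And>b. b \<in> Basis \<Longrightarrow> Ck n (\<lambda>x. D' x b)" using Ck_Suc_derivative by blast
  show ?case
    by (rule Ck_SucI[OF has_derivative_mult[OF D(1) D'(1)]],
        intro Ck_add Suc.IH Ck_SucD[OF Suc.prems(1)] Ck_SucD[OF Suc.prems(2)] D D')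
qed simp

lemma Ck_cmult:
  fixes u :: "'a::euclidean_space \<Rightarrow> 'b::real_normed_algebra"
  shows "Ck n u \<Longrightarrow> Ck n (\<lambda>x. c * u x)"
  by (intro Ck_mult Ck_const)

lemma Ck_diff: "Ck n u \<Longrightarrow> Ck n v \<Longrightarrow> Ck n (\<lambda>x. u x - v x)"
  using Ck_add[of n u "\<lambda>x. - v x"] Ck_linear[OF bounded_linear_minus[OF bounded_linear_ident], of n v]
  by simp

text \<open>Differentiation lowers the exponent, hence the induction over all exponents at once. The
  exponents used are -1, for quotients, and 1/2, for the regularized modulus.\<close>

lemma Ck_powr:
  fixes p :: "'a::euclidean_space \<Rightarrow> real"
  assumes "Ck n p" "\<And>x. p x > 0" shows "Ck n (\<lambda>x. p x powr e)"
  using assms(1)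
proof (induction n arbitrary: e)
  case (Suc n)
  from Suc.prems obtain D where D: "\<And>x. (p has_derivative D x) (at x)"
    "\<And>b. b \<in> Basis \<Longrightarrow> Ck n (\<lambda>x. D x b)" using Ck_Suc_derivative by blast
  show ?case
  proof (rule Ck_SucI)
    show "((\<lambda>x. p x powr e) has_derivative (\<lambda>h. (e * p x powr (e - 1)) * D x h)) (at x)" for x
    proof -
      have "((\<lambda>t. t powr e) has_derivative (\<lambda>h. (e * p x powr (e - 1)) * h)) (at (p x))"
        using has_real_derivative_powr[OF assms(2)[of x], of e] by (simp add: has_field_derivative_def)
      from has_derivative_compose[OF D(1) this] show ?thesis .
    qed
    show "Ck n (\<lambda>x. (e * p x powr (e - 1)) * D x b)" if "b \<in> Basis" for b
      by (intro Ck_mult Ck_const Suc.IH D that Ck_SucD[OF Suc.prems])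
  qed
qed simp

lemma Ck_translate:
  assumes "Ck n u" shows "Ck n (\<lambda>x. u (x - a))"
  using assms
proof (induction n arbitrary: u)
  case (Suc n)
  from Suc.prems obtain D where D: "\<And>x. (u has_derivative D x) (at x)"
    "\<And>b. b \<in> Basis \<Longrightarrow> Ck n (\<lambda>x. D x b)" using Ck_Suc_derivative by blast
  show ?case
  proof (rule Ck_SucI)
    show "((\<lambda>x. u (x - a)) has_derivative D (x - a)) (at x)" for x
      by (rule has_derivative_compose[where f="\<lambda>x. x - a" and f'="\<lambda>h. h", OF _ D(1)])
         (auto intro!: derivative_eq_intros)
  qed (rule Suc.IH[OF D(2)])
qed simp

text \<open>In \<open>iter_partial\<close> the head of the list is the derivative taken last,
  whereas \<open>Ck\<close> removes the one taken first. Appending b at the end of a list means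
  differentiating along b first, so lists are split at their last element.\<close>

lemma smooth_iff_Ck: "smooth \<phi> \<longleftrightarrow> (\<forall>n. Ck n \<phi>)"
proof -
  have shift: "iter_partial (vs @ [b]) \<phi> = iter_partial vs (\<lambda>x. frechet_derivative \<phi> (at x) b)"
    for vs b and \<phi> :: "'a \<Rightarrow> complex" by (induction vs) auto
  have "Ck n \<phi> \<longleftrightarrow> (\<forall>vs\<in>lists Basis. length vs < n \<longrightarrow> (\<forall>x. iter_partial vs \<phi> differentiable (at x)))"
    for n
  proof (induction n arbitrary: \<phi>)
    case (Suc n)
    have split: "(\<forall>vs\<in>lists (Basis::'a set). length vs < Suc n \<longrightarrow> P vs) \<longleftrightarrow>
       P [] \<and> (\<forall>b\<in>Basis. \<forall>vs\<in>lists Basis. length vs < n \<longrightarrow> P (vs @ [b]))" for P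
    proof (intro iffI conjI ballI impI)
      fix vs :: "'a list" assume *: "P [] \<and> (\<forall>b\<in>Basis. \<forall>vs\<in>lists Basis. length vs < n \<longrightarrow> P (vs @ [b]))"
        "vs \<in> lists Basis" "length vs < Suc n"
      then show "P vs" by (cases vs rule: rev_cases) auto
    qed auto
    show ?case
      unfolding Ck.simps Suc.IH split by (simp add: shift)
  qed simp
  then show ?thesis unfolding smooth_def by blast
qed

section \<open>Functions that are flat at the origin, and smooth bumps\<close>

text \<open>These are the functions exp(-1/t) / t^m, extended by 0 to t \<le> 0. The parameter m
  makes the family closed under differentiation up to linear combinations, so that smoothness
  follows by induction on the order.\<close>

definition flat :: "nat \<Rightarrow> real \<Rightarrow> real"
  where "flat m t = (if t > 0 then exp (- inverse t) * inverse t ^ m else 0)"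

lemma flat_has_derivative:
  "(flat m has_real_derivative (flat (m + 2) t - real m * flat (Suc m) t)) (at t)"
proof -
  consider "t > 0" | "t < 0" | "t = 0" by linarith
  then show ?thesis
  proof cases
    case 1
    have "((\<lambda>t. exp (- inverse t) * inverse t ^ m) has_real_derivative
        (flat (m + 2) t - real m * flat (Suc m) t)) (at t)"
      (is "(_ has_real_derivative ?D) _")
    proof -
      have inv: "(inverse has_real_derivative - (inverse t ^ 2)) (at t)"
        using 1 DERIV_inverse[of t UNIV] by (simp add: numeral_2_eq_2)
      \<comment> \<open>For m = 0 the exponent m - 1 is truncated to 0; the factor
        \<open>real m\<close> removes that term.\<close>
      have "((\<lambda>t. exp (- inverse t) * inverse t ^ m) has_real_derivative
          exp (- inverse t) * (inverse t ^ 2) * inverse t ^ m +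
          (real m * (- (inverse t ^ 2) * inverse t ^ (m - 1))) * exp (- inverse t)) (at t)"
        using DERIV_mult[OF DERIV_fun_exp[OF DERIV_minus[OF inv]] DERIV_power[OF inv, of m]]
        by (simp add: ac_simps)
      also have "exp (- inverse t) * (inverse t ^ 2) * inverse t ^ m +
          (real m * (- (inverse t ^ 2) * inverse t ^ (m - 1))) * exp (- inverse t) = ?D"
        using 1 by (cases m) (simp_all add: flat_def power2_eq_square algebra_simps)
      finally show ?thesis .
    qed
    then show ?thesis
      by (rule has_field_derivative_transform_within_open[where S="{0<..}"])
         (use 1 in \<open>auto simp: flat_def\<close>)
  next
    case 2
    have "((\<lambda>t::real. 0) has_real_derivative (flat (m + 2) t - real m * flat (Suc m) t)) (at t)"
      using 2 by (simp add: flat_def)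
    then show ?thesis
      by (rule has_field_derivative_transform_within_open[where S="{..<0}"])
         (use 2 in \<open>auto simp: flat_def\<close>)
  next
    case 3
    \<comment> \<open>At the origin the difference quotient of \<open>flat m\<close> is
      \<open>flat (Suc m)\<close>; its right limit comes from the decay of s^(m+1) / exp s under the
      substitution s = 1/h.\<close>
    have "((\<lambda>s::real. s ^ Suc m / exp s) \<longlongrightarrow> 0) at_top"
      by (rule tendsto_power_div_exp_0)
    then have "((\<lambda>h::real. inverse h ^ Suc m / exp (inverse h)) \<longlongrightarrow> 0) (at_right 0)"
      by (rule filterlim_compose[OF _ filterlim_inverse_at_top_right])
    then have "(flat (Suc m) \<longlongrightarrow> 0) (at_right 0)"
      by (rule Lim_transform_eventually)
         (auto simp: flat_def eventually_at_filter exp_minus divide_inverse mult.commute)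
    moreover have "(flat (Suc m) \<longlongrightarrow> 0) (at_left 0)"
      by (rule Lim_transform_eventually[OF tendsto_const])
         (auto simp: flat_def eventually_at_filter)
    ultimately have "(flat (Suc m) \<longlongrightarrow> 0) (at 0)"
      by (simp add: filterlim_split_at)
    then have "((\<lambda>h. (flat m (0 + h) - flat m 0) / h) \<longlongrightarrow> 0) (at 0)"
      by (rule Lim_transform_eventually)
         (auto simp: flat_def eventually_at_filter divide_inverse)
    then show ?thesis using 3 by (simp add: DERIV_def flat_def)
  qed
qed

lemma Ck_flat:
  fixes q :: "'a::euclidean_space \<Rightarrow> real"
  assumes "Ck n q" shows "Ck n (\<lambda>x. flat m (q x))"
  using assms(1)
proof (induction n arbitrary: m)
  case (Suc n)
  from Suc.prems obtain D where D: "\<And>x. (q has_derivative D x) (at x)"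
    "\<And>b. b \<in> Basis \<Longrightarrow> Ck n (\<lambda>x. D x b)" using Ck_Suc_derivative by blast
  show ?case
  proof (rule Ck_SucI)
    show "((\<lambda>x. flat m (q x)) has_derivative
        (\<lambda>h. (flat (m + 2) (q x) - real m * flat (Suc m) (q x)) * D x h)) (at x)" for x
      using has_derivative_compose[OF D(1) flat_has_derivative[unfolded has_field_derivative_def]] .
    show "Ck n (\<lambda>x. (flat (m + 2) (q x) - real m * flat (Suc m) (q x)) * D x b)"
      if "b \<in> Basis" for b
      by (intro Ck_mult Ck_diff Ck_const Suc.IH D that Ck_SucD[OF Suc.prems])
  qed
qed simp

lemma Ck_inner_self: "Ck n (\<lambda>x::'a::euclidean_space. (x - a) \<bullet> (x - a))"
proof (cases n)
  case (Suc m)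
  have lin: "Ck k (\<lambda>x::'a. x \<bullet> b)" for k b
  proof (cases k)
    case (Suc j)
    show ?thesis unfolding Suc
      by (rule Ck_SucI[where D="\<lambda>x h. h \<bullet> b"])
         (auto intro!: derivative_eq_intros Ck_const)
  qed simp
  show ?thesis unfolding Suc
  proof (rule Ck_SucI)
    show "((\<lambda>x::'a. (x - a) \<bullet> (x - a)) has_derivative (\<lambda>h. 2 * (x \<bullet> h - a \<bullet> h))) (at x)" for x
      by (auto intro!: derivative_eq_intros simp: inner_commute inner_diff_left inner_diff_right fun_eq_iff)
    show "Ck m (\<lambda>x::'a. 2 * (x \<bullet> b - a \<bullet> b))" for b
      by (intro Ck_mult Ck_diff Ck_const lin)
  qed
qed simp

lemma Ck_imp_continuous: "Ck 1 u \<Longrightarrow> continuous_on S u"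
  by (auto simp: continuous_on_eq_continuous_at differentiable_imp_continuous_within
      intro: continuous_at_imp_continuous_on)

lemma Ck_prod:
  fixes u :: "'i \<Rightarrow> 'a::euclidean_space \<Rightarrow> real"
  assumes "\<And>i. i \<in> I \<Longrightarrow> Ck n (u i)" shows "Ck n (\<lambda>x. \<Prod>i\<in>I. u i x)"
  using assms by (induction I rule: infinite_finite_induct) (auto intro: Ck_const Ck_mult)

text \<open>The bump is A / (A + B), where A vanishes from radius 2r outwards and B up to radius r.
  The denominator is positive because these two regions are disjoint. The squared distance is used
  since it is smooth at the center as well.\<close>

lemma smooth_bump:
  fixes a :: "'a::euclidean_space"
  assumes "r > 0"
  obtains b :: "'a \<Rightarrow> real" where "\<And>n. Ck n b" "\<And>x. 0 \<le> b x" "\<And>x. b x \<le> 1"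
    "\<And>x. dist a x \<le> r \<Longrightarrow> b x = 1" "\<And>x. 2 * r \<le> dist a x \<Longrightarrow> b x = 0"
proof -
  define q :: "'a \<Rightarrow> real" where "q x = (x - a) \<bullet> (x - a)" for x
  have q: "q x = (dist a x)\<^sup>2" for x
    by (simp add: q_def dist_norm power2_norm_eq_inner[symmetric] norm_minus_commute)
  define A where "A x = flat 0 (4 * r\<^sup>2 - q x)" for x
  define B where "B x = flat 0 (q x - r\<^sup>2)" for x
  have pos: "0 \<le> A x" "0 \<le> B x" "0 < A x + B x" for x
  proof -
    have "0 < 3 * r\<^sup>2" using assms by simp
    then have "q x < 4 * r\<^sup>2 \<or> r\<^sup>2 < q x" by linarith
    then show "0 < A x + B x"
      by (auto simp: A_def B_def flat_def intro!: add_pos_nonneg add_nonneg_pos)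
  qed (simp_all add: A_def B_def flat_def)
  \<comment> \<open>The reciprocal is written as a power so that \<open>Ck_powr\<close>
    applies.\<close>
  let ?b = "\<lambda>x. A x * (A x + B x) powr (-1)"
  have b: "?b x = A x / (A x + B x)" for x
    using pos[of x] by (simp add: powr_minus divide_inverse)
  show thesis
  proof (rule that[of ?b])
    show "Ck n ?b" for n
      unfolding A_def B_def q_def
      by (intro Ck_mult Ck_powr Ck_add Ck_flat Ck_diff Ck_const Ck_inner_self)
         (use pos in \<open>auto simp: A_def B_def q_def\<close>)
    show "0 \<le> ?b x" "?b x \<le> 1" for x
      using pos[of x] by (auto simp: b)
    show "?b x = 1" if "dist a x \<le> r" for x
    proof -
      have "q x \<le> r\<^sup>2" using that by (simp add: q power_mono)
      then have "B x = 0" by (simp add: B_def flat_def)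
      then show ?thesis using pos[of x] by (simp add: b)
    qed
    show "?b x = 0" if "2 * r \<le> dist a x" for x
    proof -
      have "(2 * r)\<^sup>2 \<le> q x" unfolding q using that assms by (intro power_mono) auto
      then have "4 * r\<^sup>2 \<le> q x" by (simp add: power_mult_distrib)
      then have "A x = 0" by (simp add: A_def flat_def)
      then show ?thesis by simp
    qed
  qed
qed

section \<open>Real test functions and a smooth Urysohn lemma\<close>

text \<open>\<open>K\<close> is any compact set outside of which \<open>u\<close> vanishes, not
  necessarily the support: no closures have to be computed, and for a sum one takes the union of two
  such sets.\<close>

definition real_test :: "'a::euclidean_space set \<Rightarrow> ('a \<Rightarrow> real) set"
  where "real_test U = {u. (\<forall>n. Ck n u) \<and> (\<exists>K. compact K \<and> K \<subseteq> U \<and> (\<forall>x. x \<notin> K \<longrightarrow> u x = 0))}"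

lemma real_testI:
  assumes "\<And>n. Ck n u" "compact K" "K \<subseteq> U" "\<And>x. x \<notin> K \<Longrightarrow> u x = 0"
  shows "u \<in> real_test U"
  using assms unfolding real_test_def by blast

lemma smooth_urysohn:
  fixes K U :: "'a::euclidean_space set"
  assumes "compact K" "open U" "K \<subseteq> U"
  obtains u where "u \<in> real_test U" "\<And>x. 0 \<le> u x" "\<And>x. u x \<le> 1" "\<And>x. x \<in> K \<Longrightarrow> u x = 1"
proof -
  have "\<exists>r>0. cball a (2 * r) \<subseteq> U" if aK: "a \<in> K" for a
  proof -
    obtain e where "e > 0" "cball a e \<subseteq> U"
      using subsetD[OF assms(3) aK] open_contains_cball_eq[OF assms(2)] by auto
    then show ?thesis by (intro exI[of _ "e/2"]) auto
  qed
  then obtain r where r: "\<And>a. a \<in> K \<Longrightarrow> r a > 0 \<and> cball a (2 * r a) \<subseteq> U" by metis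
  have "\<exists>b. (\<forall>n. Ck n b) \<and> (\<forall>x. 0 \<le> b x \<and> b x \<le> 1) \<and> (\<forall>x. dist a x \<le> r a \<longrightarrow> b x = 1)
      \<and> (\<forall>x. 2 * r a \<le> dist a x \<longrightarrow> b x = (0::real))" if "a \<in> K" for a
    by (rule smooth_bump[of "r a" a]) (use r[OF that] in auto)
  then obtain b where b: "\<And>a n. a \<in> K \<Longrightarrow> Ck n (b a)" "\<And>a x. a \<in> K \<Longrightarrow> 0 \<le> b a x \<and> b a x \<le> 1"
      "\<And>a x. a \<in> K \<Longrightarrow> dist a x \<le> r a \<Longrightarrow> b a x = 1"
      "\<And>a x. a \<in> K \<Longrightarrow> 2 * r a \<le> dist a x \<Longrightarrow> b a x = (0::real)" by metis
  have "K \<subseteq> (\<Union>a\<in>K. ball a (r a))" using r by force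
  then obtain F where F: "F \<subseteq> K" "finite F" "K \<subseteq> (\<Union>a\<in>F. ball a (r a))"
    using compactE_image[OF assms(1), of K "\<lambda>a. ball a (r a)"] by auto
  \<comment> \<open>The product vanishes as soon as one bump equals 1, which happens on all of K,
    and equals 1 where every bump is 0. This glues finitely many bumps without leaving the interval
    [0, 1].\<close>
  let ?u = "\<lambda>x. 1 - (\<Prod>a\<in>F. 1 - b a x)"
  have P: "0 \<le> (\<Prod>a\<in>F. 1 - b a x)" "(\<Prod>a\<in>F. 1 - b a x) \<le> 1" for x
    using F b(2) by (auto intro!: prod_nonneg prod_le_1 simp: subset_eq)
  show thesis
  proof
    have "Ck n ?u" for n
      using F b by (intro Ck_diff Ck_const Ck_prod) auto
    moreover have "compact (\<Union>a\<in>F. cball a (2 * r a))" "(\<Union>a\<in>F. cball a (2 * r a)) \<subseteq> U"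
      using F r by auto
    moreover have "?u x = 0" if "x \<notin> (\<Union>a\<in>F. cball a (2 * r a))" for x
      using that F b(4) by (auto intro!: prod.neutral simp: subset_eq)
    ultimately show "?u \<in> real_test U" unfolding real_test_def by blast
    show "0 \<le> ?u x" "?u x \<le> 1" for x using P by auto
    show "?u x = 1" if xK: "x \<in> K" for x
    proof -
      obtain a where "a \<in> F" "dist a x < r a" using F(3) xK by auto
      then have "(\<Prod>a\<in>F. 1 - b a x) = 0"
        using F b(3)[of a x] by (intro prod_zero) auto
      then show ?thesis by simp
    qed
  qed
qed

subsection \<open>Density of smooth functions in \<open>L\<^sup>1\<close>\<close>

lemma real_test_Ck: "u \<in> real_test U \<Longrightarrow> Ck n u"
  by (simp add: real_test_def)

lemma real_test_continuous: "u \<in> real_test U \<Longrightarrow> continuous_on S u"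
  by (blast intro: Ck_imp_continuous real_test_Ck)

lemma real_test_borel: "u \<in> real_test U \<Longrightarrow> u \<in> borel_measurable borel"
  by (blast intro: borel_measurable_continuous_onI real_test_continuous)

lemma real_test_eq_0: "u \<in> real_test U \<Longrightarrow> x \<notin> U \<Longrightarrow> u x = 0"
  by (auto simp: real_test_def)

lemma real_test_integrable:
  assumes "u \<in> real_test U" shows "integrable lborel u"
proof -
  obtain K where K: "compact K" "\<And>x. x \<notin> K \<Longrightarrow> u x = 0"
    using assms by (auto simp: real_test_def)
  have "integrable lborel (\<lambda>x. indicator K x *\<^sub>R u x)"
    by (rule borel_integrable_compact[OF K(1) real_test_continuous[OF assms]])
  also have "(\<lambda>x. indicator K x *\<^sub>R u x) = u"
    using K(2) by (auto simp: indicator_def fun_eq_iff)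
  finally show ?thesis .
qed

lemma real_test_mono: "u \<in> real_test U \<Longrightarrow> U \<subseteq> V \<Longrightarrow> u \<in> real_test V"
  by (auto simp: real_test_def)

lemma real_test_zero: "(\<lambda>x. 0) \<in> real_test U"
  by (auto simp: real_test_def intro: Ck_const)

lemma real_test_mult:
  assumes "u \<in> real_test U" "\<And>n. Ck n v" shows "(\<lambda>x. v x * u x) \<in> real_test U"
  using assms by (auto simp: real_test_def intro: Ck_mult)

lemma real_test_scale: "u \<in> real_test U \<Longrightarrow> (\<lambda>x. c * u x) \<in> real_test U"
  by (intro real_test_mult Ck_const)

lemma real_test_add:
  assumes "u \<in> real_test U" "v \<in> real_test U" shows "(\<lambda>x. u x + v x) \<in> real_test U"
proof -
  obtain K L where "compact K" "K \<subseteq> U" "\<forall>x. x \<notin> K \<longrightarrow> u x = 0" "compact L" "L \<subseteq> U" "\<forall>x. x \<notin> L \<longrightarrow> v x = 0"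
    using assms by (auto simp: real_test_def)
  then have "compact (K \<union> L) \<and> K \<union> L \<subseteq> U \<and> (\<forall>x. x \<notin> K \<union> L \<longrightarrow> u x + v x = 0)"
    by auto
  then have "\<exists>K. compact K \<and> K \<subseteq> U \<and> (\<forall>x. x \<notin> K \<longrightarrow> u x + v x = 0)"
    by blast
  then show ?thesis
    using assms by (auto simp: real_test_def intro: Ck_add)
qed

lemma real_test_diff:
  assumes "u \<in> real_test U" "v \<in> real_test U" shows "(\<lambda>x. u x - v x) \<in> real_test U"
proof -
  have "(\<lambda>x. u x + -1 * v x) \<in> real_test U"
    by (intro real_test_add real_test_scale assms)
  then show ?thesis by simp
qed

text \<open>Outer regularity of A \<inter> U and of its complement encloses A \<inter> U between a
  closed and an open set with a small gap; boundedness of U makes the closed set compact. A smooth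
  cutoff between the two differs from the indicator on the gap only.\<close>

lemma real_test_dense_indicator:
  fixes A U :: "'a::euclidean_space set"
  assumes "open U" "bounded U" "A \<in> sets borel" "e > 0"
  shows "\<exists>u\<in>real_test U. (\<integral>x. \<bar>u x - indicator U x * indicator A x\<bar> \<partial>lborel) < e"
proof -
  have m: "A \<inter> U \<in> sets borel" "- (A \<inter> U) \<in> sets borel"
    using assms by auto
  have e: "e / 4 > 0" using assms by simp
  obtain V where V: "open V" "A \<inter> U \<subseteq> V" "emeasure lborel (V - A \<inter> U) \<le> ennreal (e/4)"
    by (rule outer_regular_lborel_le[OF m(1) e])
  obtain W where W: "open W" "- (A \<inter> U) \<subseteq> W" "emeasure lborel (W - - (A \<inter> U)) \<le> ennreal (e/4)"
    by (rule outer_regular_lborel_le[OF m(2) e])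
  have "- W \<subseteq> U" "closed (- W)" using W by auto
  then have K: "compact (- W)"
    using assms(2) bounded_subset compact_eq_bounded_closed by blast
  have KV: "- W \<subseteq> V \<inter> U" using W V by auto
  obtain u where u: "u \<in> real_test (V \<inter> U)" "\<And>x. 0 \<le> u x" "\<And>x. u x \<le> 1" "\<And>x. x \<in> - W \<Longrightarrow> u x = 1"
    using smooth_urysohn[OF K _ KV] V(1) assms(1) by blast
  let ?D = "(V - A \<inter> U) \<union> (W - - (A \<inter> U))"
  have D: "?D \<in> sets lborel" using V W m by auto
  have "emeasure lborel ?D \<le> ennreal (e/4) + ennreal (e/4)"
    by (rule order_trans[OF emeasure_subadditive add_mono[OF V(3) W(3)]])
       (use V(1) W(1) m in auto)
  also have "\<dots> = ennreal (e/2)"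
    using assms(4) by (subst ennreal_plus[symmetric]) auto
  finally have eD: "emeasure lborel ?D \<le> ennreal (e/2)" .
  then have fin: "emeasure lborel ?D < \<infinity>"
    by (simp add: order_le_less_trans)
  have "\<bar>u x - indicator U x * indicator A x\<bar> \<le> indicator ?D x" for x
    using u(2)[of x] u(3)[of x] u(4)[of x] real_test_eq_0[OF u(1), of x] V(2)
    by (auto simp: indicator_def split: if_splits)
  then have "(\<integral>x. \<bar>u x - indicator U x * indicator A x\<bar> \<partial>lborel) \<le> (\<integral>x. indicator ?D x \<partial>lborel)"
    using D fin by (intro integral_mono') (auto simp: integrable_real_indicator)
  also have "\<dots> = measure lborel ?D" using D by simp
  also have "\<dots> \<le> e/2"
    unfolding measure_def using eD assms(4) by (intro enn2real_leI) simp_all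
  also have "\<dots> < e" using assms by simp
  finally show ?thesis using real_test_mono[OF u(1)] by blast
qed

lemma integrable_indicator_mult:
  fixes h :: "'a \<Rightarrow> real"
  shows "A \<in> sets M \<Longrightarrow> integrable M h \<Longrightarrow> integrable M (\<lambda>x. indicator A x * h x)"
  using integrable_real_mult_indicator[of A M h] by (simp add: mult.commute)

lemma real_test_diff_integrable:
  assumes "open U" "u \<in> real_test U" "integrable lborel h"
  shows "integrable lborel (\<lambda>x. u x - indicator U x * h x)"
  using assms
  by (intro Bochner_Integration.integrable_diff real_test_integrable[OF assms(2)] integrable_indicator_mult) auto

text \<open>The hypotheses are those supplied by the limit case of \<open>integrable_induct\<close>;
  the bound 2 |f| on the approximants makes 3 |f| a dominating function for the differences.\<close>

lemma L1_dominated_convergence: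
  fixes f :: "'a \<Rightarrow> real"
  assumes s: "\<And>i. integrable M (s i)" and f: "integrable M f"
    and lim: "\<And>x. x \<in> space M \<Longrightarrow> (\<lambda>i. s i x) \<longlonglongrightarrow> f x"
    and bound: "\<And>i x. x \<in> space M \<Longrightarrow> norm (s i x) \<le> 2 * norm (f x)"
  shows "(\<lambda>i. \<integral>x. \<bar>s i x - f x\<bar> \<partial>M) \<longlonglongrightarrow> 0"
proof -
  have "(\<lambda>i. \<integral>x. \<bar>s i x - f x\<bar> \<partial>M) \<longlonglongrightarrow> integral\<^sup>L M (\<lambda>x. 0)"
  proof (rule integral_dominated_convergence[where w="\<lambda>x. 3 * \<bar>f x\<bar>"])
    show "AE x in M. (\<lambda>i. \<bar>s i x - f x\<bar>) \<longlonglongrightarrow> 0"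
      using lim by (auto intro!: tendsto_rabs_zero LIM_zero)
    show "AE x in M. norm \<bar>s i x - f x\<bar> \<le> 3 * \<bar>f x\<bar>" for i
    proof (rule AE_I2)
      fix x assume "x \<in> space M"
      from bound[OF this, of i] show "norm \<bar>s i x - f x\<bar> \<le> 3 * \<bar>f x\<bar>" by simp
    qed
  qed (use s f in auto)
  then show ?thesis by simp
qed

lemma real_test_dense:
  fixes U :: "'a::euclidean_space set"
  assumes "open U" "bounded U" "integrable lborel h" "e > 0"
  shows "\<exists>u\<in>real_test U. (\<integral>x. \<bar>u x - indicator U x * h x\<bar> \<partial>lborel) < e"
  using assms(3,4)
proof (induction h arbitrary: e rule: integrable_induct)
  case (base A c)
  \<comment> \<open>The summand 1 covers the case c = 0.\<close>
  have "e / (\<bar>c\<bar> + 1) > 0" using base by simp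
  then obtain u where u: "u \<in> real_test U"
      "(\<integral>x. \<bar>u x - indicator U x * indicator A x\<bar> \<partial>lborel) < e / (\<bar>c\<bar> + 1)"
    using real_test_dense_indicator[OF assms(1,2), of A "e / (\<bar>c\<bar> + 1)"] base by auto
  have "(\<integral>x. \<bar>c * u x - indicator U x * (indicator A x *\<^sub>R c)\<bar> \<partial>lborel)
      = (\<integral>x. \<bar>c\<bar> * \<bar>u x - indicator U x * indicator A x\<bar> \<partial>lborel)"
    by (intro Bochner_Integration.integral_cong) (auto simp: abs_mult[symmetric] algebra_simps)
  also have "\<dots> = \<bar>c\<bar> * (\<integral>x. \<bar>u x - indicator U x * indicator A x\<bar> \<partial>lborel)"
    by simp
  also have "\<dots> \<le> (\<bar>c\<bar> + 1) * (\<integral>x. \<bar>u x - indicator U x * indicator A x\<bar> \<partial>lborel)"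
    by (intro mult_right_mono) auto
  also have "\<dots> < e" using u(2) by (simp add: field_simps)
  finally show ?case by (intro bexI[OF _ real_test_scale[OF u(1), of c]])
next
  case (add f g)
  obtain u where u: "u \<in> real_test U" "(\<integral>x. \<bar>u x - indicator U x * f x\<bar> \<partial>lborel) < e/2"
    using add.IH(1)[of "e/2"] add.prems by auto
  obtain v where v: "v \<in> real_test U" "(\<integral>x. \<bar>v x - indicator U x * g x\<bar> \<partial>lborel) < e/2"
    using add.IH(2)[of "e/2"] add.prems by auto
  have i: "integrable lborel (\<lambda>x. u x - indicator U x * f x)"
          "integrable lborel (\<lambda>x. v x - indicator U x * g x)"
    using real_test_diff_integrable[OF assms(1)] u(1) v(1) add.hyps by auto
  have "(\<integral>x. \<bar>u x + v x - indicator U x * (f x + g x)\<bar> \<partial>lborel)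
     \<le> (\<integral>x. \<bar>u x - indicator U x * f x\<bar> + \<bar>v x - indicator U x * g x\<bar> \<partial>lborel)"
    using i by (intro integral_mono') (auto simp: algebra_simps)
  also have "\<dots> < e" using u(2) v(2) i by (subst Bochner_Integration.integral_add) auto
  finally show ?case by (intro bexI[OF _ real_test_add[OF u(1) v(1)]])
next
  case (lim f s)
  have "(\<lambda>i. \<integral>x. \<bar>s i x - f x\<bar> \<partial>lborel) \<longlonglongrightarrow> 0"
    by (rule L1_dominated_convergence) (use lim.hyps in auto)
  then have "eventually (\<lambda>i. (\<integral>x. \<bar>s i x - f x\<bar> \<partial>lborel) < e/2) sequentially"
    using lim.prems by (intro order_tendstoD) auto
  then obtain i where i: "(\<integral>x. \<bar>s i x - f x\<bar> \<partial>lborel) < e/2"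
    by (auto simp: eventually_sequentially)
  obtain u where u: "u \<in> real_test U" "(\<integral>x. \<bar>u x - indicator U x * s i x\<bar> \<partial>lborel) < e/2"
    using lim.IH[of "e/2" i] lim.prems by auto
  have int: "integrable lborel (\<lambda>x. u x - indicator U x * s i x)" "integrable lborel (\<lambda>x. s i x - f x)"
    using real_test_diff_integrable[OF assms(1) u(1)] lim.hyps by auto
  have "(\<integral>x. \<bar>u x - indicator U x * f x\<bar> \<partial>lborel)
     \<le> (\<integral>x. \<bar>u x - indicator U x * s i x\<bar> + \<bar>s i x - f x\<bar> \<partial>lborel)"
    using int by (intro integral_mono') (auto simp: indicator_def)
  also have "\<dots> < e" using u(2) i int by (subst Bochner_Integration.integral_add) auto
  finally show ?case by (intro bexI[OF _ u(1)])
qed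

text \<open>Test on the set where f is negative: the integral there must be 0, so the set is
  null.\<close>

lemma AE_nonneg_if_set_integrals_nonneg:
  fixes f :: "'a \<Rightarrow> real"
  assumes f: "integrable M f" and nn: "\<And>A. A \<in> sets M \<Longrightarrow> 0 \<le> (\<integral>x. indicator A x * f x \<partial>M)"
  shows "AE x in M. 0 \<le> f x"
proof -
  let ?A = "{x\<in>space M. f x < 0}"
  have A: "?A \<in> sets M" using f by measurable
  have int: "integrable M (\<lambda>x. - (indicator ?A x * f x))"
    using integrable_indicator_mult[OF A f] by simp
  have nonneg: "AE x in M. 0 \<le> - (indicator ?A x * f x)" by (auto simp: indicator_def)
  then have "0 \<le> (\<integral>x. - (indicator ?A x * f x) \<partial>M)" by (rule integral_nonneg_AE)
  then have "(\<integral>x. - (indicator ?A x * f x) \<partial>M) = 0" using nn[OF A] by simp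
  then have "AE x in M. - (indicator ?A x * f x) = 0"
    using integral_nonneg_eq_0_iff_AE[OF int nonneg] by simp
  then show ?thesis
    by (rule AE_mp) (auto simp: indicator_def not_less intro!: AE_I2 split: if_splits)
qed

subsection \<open>Extension of bounded functionals to \<open>L\<^sup>1\<close>\<close>

lemma eq_0_if_abs_le_mult:
  fixes x :: real
  assumes "c \<ge> 0" "\<And>e. e > 0 \<Longrightarrow> \<bar>x\<bar> \<le> c * e" shows "x = 0"
proof (rule ccontr)
  assume "x \<noteq> 0"
  \<comment> \<open>This e turns the right-hand side into less than half of |x|.\<close>
  then have "\<bar>x\<bar> \<le> c * (\<bar>x\<bar> / (2 * (c + 1)))" using assms(1) by (intro assms(2)) auto
  then have "\<bar>x\<bar> * (c + 2) \<le> 0" using assms(1) by (simp add: field_simps)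
  moreover have "\<bar>x\<bar> * (c + 2) > 0" using \<open>x \<noteq> 0\<close> assms(1) by simp
  ultimately show False by simp
qed

text \<open>The bound is asked for nonnegative functions, as this is what positive delta sequences
  provide. The locale is entered with \<open>T\<close> the real and the imaginary part of f - c, and
  with \<open>T\<close> the integration against a given function.\<close>

locale bounded_test_functional =
  fixes U :: "'a::euclidean_space set" and T :: "('a \<Rightarrow> real) \<Rightarrow> real" and C :: real
  assumes open_U: "open U" and bounded_U: "bounded U" and C: "C \<ge> 0"
    and add: "u \<in> real_test U \<Longrightarrow> v \<in> real_test U \<Longrightarrow> T (\<lambda>x. u x + v x) = T u + T v"
    and scale: "u \<in> real_test U \<Longrightarrow> T (\<lambda>x. c * u x) = c * T u"
    and nonneg_bound: "u \<in> real_test U \<Longrightarrow> (\<And>x. 0 \<le> u x) \<Longrightarrow> \<bar>T u\<bar> \<le> C * (\<integral>x. u x \<partial>lborel)"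
begin

lemma diff:
  assumes "u \<in> real_test U" "v \<in> real_test U" shows "T (\<lambda>x. u x - v x) = T u - T v"
  using add[OF assms(1) real_test_scale[OF assms(2), of "-1"]] scale[OF assms(2), of "-1"] by simp

lemma U_sets [measurable]: "U \<in> sets borel"
  using open_U by simp

text \<open>With a cutoff \<open>w\<close> equal to 1 on the support of \<open>u\<close>, the test function
  \<open>s = sqrt (u\<^sup>2 + \<delta>\<^sup>2) - \<delta> + \<delta>w\<close> is a smooth majorant of \<open>\<bar>u\<bar>\<close> whose integral is nearly that of
  \<open>\<bar>u\<bar>\<close>, and \<open>u\<close> is the difference of the nonnegative test functions \<open>(s \<plusminus> u) / 2\<close>.\<close>

lemma abs_bound:
  assumes u: "u \<in> real_test U"
  shows "\<bar>T u\<bar> \<le> C * (\<integral>x. \<bar>u x\<bar> \<partial>lborel)"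
proof -
  obtain K where K: "compact K" "K \<subseteq> U" "\<And>x. x \<notin> K \<Longrightarrow> u x = 0"
    using u by (auto simp: real_test_def)
  obtain w where w: "w \<in> real_test U" "\<And>x. 0 \<le> w x" "\<And>x. w x \<le> 1" "\<And>x. x \<in> K \<Longrightarrow> w x = 1"
    using smooth_urysohn[OF K(1) open_U K(2)] by blast
  have "\<bar>T u\<bar> \<le> C * (\<integral>x. \<bar>u x\<bar> \<partial>lborel) + C * (\<integral>x. w x \<partial>lborel) * \<delta>" if \<delta>: "\<delta> > 0" for \<delta>
  proof -
    define p where "p x = u x * u x + \<delta> * \<delta>" for x
    define s where "s x = p x powr (1/2) - \<delta> + \<delta> * w x" for x
    have p: "p x > 0" for x using \<delta> by (auto simp: p_def intro: add_nonneg_pos)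
    have ps: "p x powr (1/2) = sqrt ((u x)\<^sup>2 + \<delta>\<^sup>2)" for x
      using p[of x] by (simp add: powr_half_sqrt p_def power2_eq_square)
    \<comment> \<open>Off K the root equals \<delta>, which is subtracted again, so \<open>s\<close>
      inherits a compact support from \<open>w\<close>; on K the terms -\<delta> and \<delta> w
      cancel and the root remains.\<close>
    have s0: "s x = \<delta> * w x" if "x \<notin> K" for x
      using \<delta> K(3)[OF that] by (simp add: s_def ps)
    have abs_le: "\<bar>u x\<bar> \<le> s x" for x
    proof (cases "x \<in> K")
      case True
      have "\<bar>u x\<bar> \<le> sqrt ((u x)\<^sup>2 + \<delta>\<^sup>2)" by (rule real_le_rsqrt) simp
      then show ?thesis using w(4)[OF True] by (simp add: s_def ps)
    qed (use s0 \<delta> w(2) K(3) in simp)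
    have s_le: "s x \<le> \<bar>u x\<bar> + \<delta> * w x" for x
      using sqrt_sum_squares_le_sum_abs[of "u x" \<delta>] \<delta> by (simp add: s_def ps)
    have Ck_s: "Ck n s" for n
      unfolding s_def p_def
      by (intro Ck_add Ck_diff Ck_powr Ck_mult Ck_const real_test_Ck[OF u] real_test_Ck[OF w(1)])
         (use p in \<open>simp add: p_def\<close>)
    obtain L where L: "compact L" "L \<subseteq> U" "\<And>x. x \<notin> L \<Longrightarrow> w x = 0"
      using w(1) by (auto simp: real_test_def)
    have "s x = 0" if "x \<notin> L" for x
      using s0[of x] w(4)[of x] L(3)[OF that] by fastforce
    then have s: "s \<in> real_test U" using Ck_s L by (auto simp: real_test_def)
    have ip: "(\<lambda>x. 1/2 * (s x + u x)) \<in> real_test U" "(\<lambda>x. 1/2 * (s x - u x)) \<in> real_test U"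
      by (intro real_test_scale real_test_add real_test_diff s u)+
    have "T u = T (\<lambda>x. 1/2 * (s x + u x) - 1/2 * (s x - u x))" by (simp add: field_simps)
    also have "\<dots> = T (\<lambda>x. 1/2 * (s x + u x)) - T (\<lambda>x. 1/2 * (s x - u x))" by (rule diff[OF ip])
    finally have "\<bar>T u\<bar> \<le> \<bar>T (\<lambda>x. 1/2 * (s x + u x))\<bar> + \<bar>T (\<lambda>x. 1/2 * (s x - u x))\<bar>" by simp
    also have "\<dots> \<le> C * (\<integral>x. 1/2 * (s x + u x) \<partial>lborel) + C * (\<integral>x. 1/2 * (s x - u x) \<partial>lborel)"
    proof (intro add_mono nonneg_bound ip)
      show "0 \<le> 1/2 * (s x + u x)" "0 \<le> 1/2 * (s x - u x)" for x
        using abs_le[of x] by auto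
    qed
    also have "\<dots> = C * (\<integral>x. s x \<partial>lborel)"
      using real_test_integrable[OF s] real_test_integrable[OF u] by (simp add: field_simps)
    also have "\<dots> \<le> C * (\<integral>x. \<bar>u x\<bar> + \<delta> * w x \<partial>lborel)"
      using s_le C real_test_integrable[OF s] real_test_integrable[OF u] real_test_integrable[OF w(1)]
      by (intro mult_left_mono integral_mono) auto
    also have "\<dots> = C * (\<integral>x. \<bar>u x\<bar> \<partial>lborel) + C * (\<integral>x. w x \<partial>lborel) * \<delta>"
      using real_test_integrable[OF u] real_test_integrable[OF w(1)] by (simp add: algebra_simps)
    finally show ?thesis .
  qed
  then have "eventually (\<lambda>\<delta>. \<bar>T u\<bar> \<le> C * (\<integral>x. \<bar>u x\<bar> \<partial>lborel) + C * (\<integral>x. w x \<partial>lborel) * \<delta>) (at_right 0)"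
    by (auto simp: eventually_at_filter)
  moreover have "((\<lambda>\<delta>. C * (\<integral>x. \<bar>u x\<bar> \<partial>lborel) + C * (\<integral>x. w x \<partial>lborel) * \<delta>) \<longlongrightarrow>
      C * (\<integral>x. \<bar>u x\<bar> \<partial>lborel) + C * (\<integral>x. w x \<partial>lborel) * 0) (at_right 0)"
    by (intro tendsto_intros)
  ultimately show ?thesis
    using tendsto_lowerbound by fastforce
qed

text \<open>The indicator lets \<open>h\<close> range over functions integrable on the whole space,
  while only its values on U count.\<close>

definition L1dist :: "('a \<Rightarrow> real) \<Rightarrow> ('a \<Rightarrow> real) \<Rightarrow> real"
  where "L1dist u h = (\<integral>x. \<bar>u x - indicator U x * h x\<bar> \<partial>lborel)"

lemma approx:
  assumes "integrable lborel h" "e > 0" obtains u where "u \<in> real_test U" "L1dist u h < e"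
  using real_test_dense[OF open_U bounded_U assms] unfolding L1dist_def by blast

lemma T_dist:
  assumes "u \<in> real_test U" "v \<in> real_test U" "integrable lborel h"
  shows "\<bar>T u - T v\<bar> \<le> C * (L1dist u h + L1dist v h)"
proof -
  have "\<bar>T u - T v\<bar> = \<bar>T (\<lambda>x. u x - v x)\<bar>" using diff[OF assms(1,2)] by simp
  also have "\<dots> \<le> C * (\<integral>x. \<bar>u x - v x\<bar> \<partial>lborel)" by (rule abs_bound[OF real_test_diff[OF assms(1,2)]])
  also have "\<dots> \<le> C * (\<integral>x. \<bar>u x - indicator U x * h x\<bar> + \<bar>v x - indicator U x * h x\<bar> \<partial>lborel)"
    using real_test_diff_integrable[OF open_U _ assms(3)] assms(1,2)
    by (intro mult_left_mono C integral_mono') auto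
  also have "\<dots> = C * (L1dist u h + L1dist v h)"
    using real_test_diff_integrable[OF open_U _ assms(3)] assms(1,2) unfolding L1dist_def
    by (subst Bochner_Integration.integral_add) auto
  finally show ?thesis .
qed

text \<open>Extension by continuity. The value is characterized by its distances to all values on
  test functions rather than as the limit along one sequence. As test functions come arbitrarily
  close to an integrable \<open>h\<close>, only one L can qualify, and later proofs may compare with
  any test function.\<close>

definition ext :: "('a \<Rightarrow> real) \<Rightarrow> real"
  where "ext h = (SOME L. \<forall>u\<in>real_test U. \<bar>T u - L\<bar> \<le> C * L1dist u h)"

lemma ext_dist:
  assumes h: "integrable lborel h" and u: "u \<in> real_test U"
  shows "\<bar>T u - ext h\<bar> \<le> C * L1dist u h"
proof -
  have "\<exists>u\<in>real_test U. L1dist u h < inverse (real (Suc n))" for n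
    by (rule approx[OF h, of "inverse (real (Suc n))"]) auto
  then obtain a where a: "\<And>n. a n \<in> real_test U" "\<And>n. L1dist (a n) h < inverse (real (Suc n))"
    by metis
  \<comment> \<open>The case d = 0 serves for the Cauchy property, d = \<open>L1dist v h\<close> for
    the estimate against the limit.\<close>
  have lim: "(\<lambda>n. C * (d + inverse (real (Suc n)))) \<longlonglongrightarrow> C * (d + 0)" for d
    by (intro tendsto_intros LIMSEQ_inverse_real_of_nat)
  have "Cauchy (\<lambda>n. T (a n))"
  proof (rule CauchyI')
    fix e :: real assume "e > 0"
    obtain N where N: "C * (0 + inverse (real (Suc N))) < e/2"
      using order_tendstoD(2)[OF lim[of 0], of "e/2"] \<open>e > 0\<close>
      by (auto simp: eventually_sequentially)
    have "dist (T (a m)) (T (a n)) < e" if "N \<le> m" "m < n" for m n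
    proof -
      have *: "C * L1dist (a k) h < e/2" if "N \<le> k" for k
      proof -
        have "L1dist (a k) h \<le> inverse (real (Suc N))"
          using a(2)[of k] le_imp_inverse_le[of "real (Suc N)" "real (Suc k)"] that by linarith
        then have "C * L1dist (a k) h \<le> C * inverse (real (Suc N))" by (intro mult_left_mono C)
        then show ?thesis using N by simp
      qed
      show ?thesis
        using T_dist[OF a(1)[of m] a(1)[of n] h] *[of m] *[of n] that by (simp add: distrib_left dist_real_def)
    qed
    then show "\<exists>N. \<forall>m\<ge>N. \<forall>n>m. dist (T (a m)) (T (a n)) < e" by blast
  qed
  then obtain L where L: "(\<lambda>n. T (a n)) \<longlonglongrightarrow> L"
    using Cauchy_convergent_iff convergent_def by blast
  have "\<bar>T v - L\<bar> \<le> C * L1dist v h" if v: "v \<in> real_test U" for v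
  proof -
    have "(\<lambda>n. \<bar>T v - T (a n)\<bar>) \<longlonglongrightarrow> \<bar>T v - L\<bar>" by (intro tendsto_intros L)
    moreover have "\<bar>T v - T (a n)\<bar> \<le> C * (L1dist v h + inverse (real (Suc n)))" for n
      using T_dist[OF v a(1)[of n] h] mult_left_mono[OF less_imp_le[OF a(2)[of n]] C]
      by (simp add: distrib_left)
    ultimately have "\<bar>T v - L\<bar> \<le> C * (L1dist v h + 0)"
      by (intro LIMSEQ_le[OF _ lim]) auto
    then show ?thesis by simp
  qed
  then have "\<exists>L. \<forall>u\<in>real_test U. \<bar>T u - L\<bar> \<le> C * L1dist u h" by blast
  from someI_ex[OF this] u show ?thesis unfolding ext_def by blast
qed

lemma ext_test: assumes "u \<in> real_test U" shows "ext u = T u"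
proof -
  have "L1dist u u = 0"
    unfolding L1dist_def using real_test_eq_0[OF assms]
    by (intro integral_eq_zero_AE) (auto simp: indicator_def)
  then show ?thesis using ext_dist[OF real_test_integrable[OF assms] assms] by simp
qed

text \<open>Compare with the zero test function: its value is 0 and its distance to \<open>h\<close>
  is the L^1 norm of \<open>h\<close> on U.\<close>

lemma ext_bound:
  assumes "integrable lborel h" shows "\<bar>ext h\<bar> \<le> C * (\<integral>x. indicator U x * \<bar>h x\<bar> \<partial>lborel)"
proof -
  have "T (\<lambda>x. 0) = 0" using scale[OF real_test_zero, of 0] by simp
  then show ?thesis using ext_dist[OF assms real_test_zero] by (simp add: L1dist_def abs_mult)
qed

lemma ext_cong: "(\<And>x. x \<in> U \<Longrightarrow> h x = k x) \<Longrightarrow> ext h = ext k"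
proof -
  assume "\<And>x. x \<in> U \<Longrightarrow> h x = k x"
  then have "(\<lambda>x. indicator U x * h x) = (\<lambda>x. indicator U x * k x)"
    by (auto simp: indicator_def fun_eq_iff)
  then have "L1dist u h = L1dist u k" for u unfolding L1dist_def by metis
  then show ?thesis by (simp add: ext_def)
qed

lemma ext_add:
  assumes h: "integrable lborel h" and k: "integrable lborel k"
  shows "ext (\<lambda>x. h x + k x) = ext h + ext k"
proof -
  \<comment> \<open>Of the four errors C e, two come from approximating h + k by u + v and one from
    each summand.\<close>
  have "\<bar>ext (\<lambda>x. h x + k x) - (ext h + ext k)\<bar> \<le> (4 * C) * e" if e: "e > 0" for e
  proof -
    obtain u where u: "u \<in> real_test U" "L1dist u h < e" using approx[OF h e] .
    obtain v where v: "v \<in> real_test U" "L1dist v k < e" using approx[OF k e] .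
    have hk: "integrable lborel (\<lambda>x. h x + k x)" using h k by simp
    have "L1dist (\<lambda>x. u x + v x) (\<lambda>x. h x + k x)
        \<le> (\<integral>x. \<bar>u x - indicator U x * h x\<bar> + \<bar>v x - indicator U x * k x\<bar> \<partial>lborel)"
      unfolding L1dist_def using real_test_diff_integrable[OF open_U u(1) h] real_test_diff_integrable[OF open_U v(1) k]
      by (intro integral_mono') (auto simp: algebra_simps)
    also have "\<dots> = L1dist u h + L1dist v k"
      unfolding L1dist_def using real_test_diff_integrable[OF open_U u(1) h] real_test_diff_integrable[OF open_U v(1) k]
      by (subst Bochner_Integration.integral_add) auto
    finally have "L1dist (\<lambda>x. u x + v x) (\<lambda>x. h x + k x) \<le> 2 * e" using u v by simp
    from mult_left_mono[OF this C]
    have "\<bar>(T u + T v) - ext (\<lambda>x. h x + k x)\<bar> \<le> C * (2 * e)"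
      using ext_dist[OF hk real_test_add[OF u(1) v(1)]] add[OF u(1) v(1)] by simp
    moreover have "\<bar>T u - ext h\<bar> \<le> C * e"
      using ext_dist[OF h u(1)] mult_left_mono[OF less_imp_le[OF u(2)] C] by simp
    moreover have "\<bar>T v - ext k\<bar> \<le> C * e"
      using ext_dist[OF k v(1)] mult_left_mono[OF less_imp_le[OF v(2)] C] by simp
    ultimately show ?thesis by linarith
  qed
  from eq_0_if_abs_le_mult[OF _ this] C show ?thesis by simp
qed

lemma ext_scale:
  assumes h: "integrable lborel h" shows "ext (\<lambda>x. c * h x) = c * ext h"
proof -
  have "\<bar>ext (\<lambda>x. c * h x) - c * ext h\<bar> \<le> (2 * \<bar>c\<bar> * C) * e" if e: "e > 0" for e
  proof -
    obtain u where u: "u \<in> real_test U" "L1dist u h < e" using approx[OF h e] .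
    have "L1dist (\<lambda>x. c * u x) (\<lambda>x. c * h x) = (\<integral>x. \<bar>c\<bar> * \<bar>u x - indicator U x * h x\<bar> \<partial>lborel)"
      unfolding L1dist_def
      by (intro Bochner_Integration.integral_cong) (auto simp: abs_mult[symmetric] algebra_simps)
    also have "\<dots> = \<bar>c\<bar> * L1dist u h" unfolding L1dist_def by simp
    finally have "\<bar>c * T u - ext (\<lambda>x. c * h x)\<bar> \<le> C * (\<bar>c\<bar> * L1dist u h)"
      using ext_dist[OF _ real_test_scale[OF u(1)], of "\<lambda>x. c * h x" c] h scale[OF u(1)] by simp
    also have "\<dots> \<le> C * (\<bar>c\<bar> * e)" using u(2) C by (intro mult_left_mono) auto
    finally have 1: "\<bar>c * T u - ext (\<lambda>x. c * h x)\<bar> \<le> C * (\<bar>c\<bar> * e)" .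
    have "\<bar>T u - ext h\<bar> \<le> C * e"
      using ext_dist[OF h u(1)] mult_left_mono[OF less_imp_le[OF u(2)] C] by simp
    from mult_left_mono[OF this, of "\<bar>c\<bar>"] have "\<bar>c * T u - c * ext h\<bar> \<le> \<bar>c\<bar> * (C * e)"
      by (simp add: abs_mult[symmetric] algebra_simps)
    then show ?thesis using 1 by (simp add: algebra_simps)
  qed
  from eq_0_if_abs_le_mult[OF _ this] C show ?thesis by simp
qed

end

subsection \<open>Representation by a bounded density\<close>

context bounded_test_functional begin

definition ext_mass :: "'a set \<Rightarrow> real"
  where "ext_mass A = ext (indicator (A \<inter> U)) + C * measure lborel (A \<inter> U)"

lemma emeasure_Int_U:
  "emeasure lborel (A \<inter> U) < \<infinity>"
  using emeasure_bounded_finite[OF bounded_subset[OF bounded_U]] by auto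

lemma integrable_indicator_Int_U:
  "A \<in> sets borel \<Longrightarrow> integrable lborel (indicator (A \<inter> U) :: 'a \<Rightarrow> real)"
  using emeasure_Int_U[of A] by (intro integrable_real_indicator) auto

text \<open>By \<open>ext_bound\<close> the first term of \<open>ext_mass\<close> is at most C times
  the measure of A \<inter> U in modulus. The lower bound permits a measure; the upper bound yields
  its countable additivity, its absolute continuity and the bound 2C on its density.\<close>

lemma ext_mass_bounds:
  assumes "A \<in> sets borel"
  shows "0 \<le> ext_mass A" "ext_mass A \<le> 2 * C * measure lborel (A \<inter> U)"
proof -
  have "(\<integral>x. indicator U x * \<bar>indicator (A \<inter> U) x :: real\<bar> \<partial>lborel) = (\<integral>x. indicator (A \<inter> U) x \<partial>lborel)"
    by (intro Bochner_Integration.integral_cong) (auto simp: indicator_def)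
  then have "(\<integral>x. indicator U x * \<bar>indicator (A \<inter> U) x :: real\<bar> \<partial>lborel) = measure lborel (A \<inter> U)"
    using assms by simp
  then show "0 \<le> ext_mass A" "ext_mass A \<le> 2 * C * measure lborel (A \<inter> U)"
    using ext_bound[OF integrable_indicator_Int_U[OF assms]] by (auto simp: ext_mass_def)
qed

lemma ext_mass_Un:
  assumes "A \<in> sets borel" "B \<in> sets borel" "A \<inter> B = {}"
  shows "ext_mass (A \<union> B) = ext_mass A + ext_mass B"
proof -
  have "(indicator ((A \<union> B) \<inter> U) :: 'a \<Rightarrow> real) = (\<lambda>x. indicator (A \<inter> U) x + indicator (B \<inter> U) x)"
    using assms(3) by (auto simp: indicator_def fun_eq_iff)
  moreover have "measure lborel ((A \<union> B) \<inter> U) = measure lborel (A \<inter> U) + measure lborel (B \<inter> U)"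
    unfolding Int_Un_distrib2 using assms emeasure_Int_U[of A] emeasure_Int_U[of B]
    by (intro measure_Union) auto
  ultimately show ?thesis
    using ext_add[OF integrable_indicator_Int_U integrable_indicator_Int_U] assms(1,2)
    by (simp add: ext_mass_def distrib_left)
qed

text \<open>Finite additivity identifies the partial sums. The remainder is the mass of a tail set,
  at most 2C times its Lebesgue measure, and this tends to 0 because Lebesgue measure is countably
  additive and finite on U.\<close>

lemma ext_mass_sums:
  assumes A: "range A \<subseteq> sets borel" and disj: "disjoint_family A"
  shows "(\<lambda>i. ext_mass (A i)) sums ext_mass (\<Union>i. A i)"
proof -
  let ?S = "\<Union>i. A i"
  have Ai: "A i \<in> sets borel" for i using A by auto
  have msums: "(\<lambda>i. measure lborel (A i \<inter> U)) sums measure lborel (\<Union>i. A i \<inter> U)"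
    using disj Ai emeasure_Int_U[of ?S]
    by (intro measure_UNION) (auto simp: disjoint_family_on_def)
  have part: "ext_mass (\<Union>i<n. A i) = (\<Sum>i<n. ext_mass (A i)) \<and>
      measure lborel ((\<Union>i<n. A i) \<inter> U) = (\<Sum>i<n. measure lborel (A i \<inter> U))" for n
  proof (induction n)
    case 0
    have "ext_mass {} = 0" using ext_mass_bounds[of "{}"] by simp
    then show ?case by simp
  next
    case (Suc n)
    have "A n \<inter> A i = {}" if "i < n" for i
      using disj that unfolding disjoint_family_on_def by (metis UNIV_I less_irrefl)
    then have "A n \<inter> (\<Union>i<n. A i) = {}" by auto
    moreover from this have "measure lborel ((A n \<inter> U) \<union> ((\<Union>i<n. A i) \<inter> U)) =
        measure lborel (A n \<inter> U) + measure lborel ((\<Union>i<n. A i) \<inter> U)"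
      using Ai emeasure_Int_U[of "A n"] emeasure_Int_U[of "\<Union>i<n. A i"]
      by (intro measure_Union) auto
    ultimately show ?case
      using Suc ext_mass_Un[of "A n" "\<Union>i<n. A i"] Ai
      by (simp add: lessThan_Suc Int_Un_distrib2)
  qed
  have bound: "norm (ext_mass ?S - (\<Sum>i<n. ext_mass (A i)))
      \<le> 2 * C * (measure lborel (\<Union>i. A i \<inter> U) - (\<Sum>i<n. measure lborel (A i \<inter> U)))" for n
  proof -
    let ?P = "\<Union>i<n. A i"
    have sets: "?P \<in> sets borel" "?S - ?P \<in> sets borel" using Ai by auto
    have S: "?S = ?P \<union> (?S - ?P)" by auto
    have "ext_mass ?S = ext_mass ?P + ext_mass (?S - ?P)"
      using ext_mass_Un[OF sets] by (subst S) blast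
    moreover have "measure lborel (\<Union>i. A i \<inter> U) = measure lborel ((?P \<inter> U) \<union> ((?S - ?P) \<inter> U))"
      by (rule arg_cong[where f="measure lborel"]) auto
    moreover have "measure lborel ((?P \<inter> U) \<union> ((?S - ?P) \<inter> U)) = measure lborel (?P \<inter> U) + measure lborel ((?S - ?P) \<inter> U)"
      using sets emeasure_Int_U[of ?P] emeasure_Int_U[of "?S - ?P"]
      by (intro measure_Union) auto
    ultimately show ?thesis
      using ext_mass_bounds[OF sets(2)] part[of n] by simp
  qed
  have "(\<lambda>n. 2 * C * (measure lborel (\<Union>i. A i \<inter> U) - (\<Sum>i<n. measure lborel (A i \<inter> U)))) \<longlonglongrightarrow>
      2 * C * (measure lborel (\<Union>i. A i \<inter> U) - measure lborel (\<Union>i. A i \<inter> U))"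
    using msums unfolding sums_def by (intro tendsto_intros)
  then have lim: "(\<lambda>n. 2 * C * (measure lborel (\<Union>i. A i \<inter> U) - (\<Sum>i<n. measure lborel (A i \<inter> U)))) \<longlonglongrightarrow> 0"
    by simp
  have "(\<lambda>n. ext_mass ?S - (\<Sum>i<n. ext_mass (A i))) \<longlonglongrightarrow> 0"
    by (rule Lim_null_comparison[OF _ lim], rule always_eventually, rule allI, rule bound)
  from tendsto_diff[OF tendsto_const[of "ext_mass ?S"] this] show ?thesis
    unfolding sums_def by simp
qed

definition ext_measure :: "'a measure"
  where "ext_measure = measure_of UNIV (sets borel) (\<lambda>A. ennreal (ext_mass A))"

lemma sets_ext_measure [simp]: "sets ext_measure = sets borel"
  unfolding ext_measure_def
  using sets.sigma_sets_eq[of "borel::'a measure"] by (subst sets_measure_of) auto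

lemma emeasure_ext_measure:
  assumes "A \<in> sets borel" shows "emeasure ext_measure A = ennreal (ext_mass A)"
proof (rule emeasure_measure_of[OF ext_measure_def])
  show "positive (sets ext_measure) (\<lambda>A. ennreal (ext_mass A))"
    using ext_mass_bounds[of "{}"] by (auto simp: positive_def)
  show "countably_additive (sets ext_measure) (\<lambda>A. ennreal (ext_mass A))"
    unfolding countably_additive_def
  proof (intro allI impI)
    fix A :: "nat \<Rightarrow> 'a set"
    assume "range A \<subseteq> sets ext_measure" "disjoint_family A"
    then have *: "range A \<subseteq> sets borel" "disjoint_family A" by auto
    show "(\<Sum>i. ennreal (ext_mass (A i))) = ennreal (ext_mass (\<Union>i. A i))"
      by (intro suminf_ennreal_eq ext_mass_sums *) (use * in \<open>auto intro: ext_mass_bounds\<close>)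
  qed
qed (use assms in auto)

lemma finite_ext_measure: "finite_measure ext_measure"
  by (rule finite_measureI)
     (use sets_eq_imp_space_eq[OF sets_ext_measure] in \<open>simp add: emeasure_ext_measure\<close>)

lemma ext_density:
  obtains g where "g \<in> borel_measurable borel" "\<And>x. 0 \<le> g x" "\<And>x. g x \<le> 2 * C"
    "\<And>A. A \<in> sets borel \<Longrightarrow> integrable lborel (\<lambda>x. g x * indicator (A \<inter> U) x)"
    "\<And>A. A \<in> sets borel \<Longrightarrow> ext_mass A = (\<integral>x. g x * indicator (A \<inter> U) x \<partial>lborel)"
proof -
  interpret fm: finite_measure ext_measure by (rule finite_ext_measure)
  have sp: "space ext_measure = UNIV"
    using sets_eq_imp_space_eq[OF sets_ext_measure] by simp
  have ac: "absolutely_continuous lborel ext_measure"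
    unfolding absolutely_continuous_def
  proof
    fix A assume A: "A \<in> null_sets (lborel :: 'a measure)"
    then have "measure lborel (A \<inter> U) = 0"
      using null_set_Int2[OF A, of U] by (auto simp: measure_def null_sets_def Int_commute)
    then have "ext_mass A = 0" using ext_mass_bounds[of A] A by (auto simp: null_sets_def)
    then show "A \<in> null_sets ext_measure"
      using A by (auto simp: null_sets_def emeasure_ext_measure)
  qed
  define k where "k x = enn2real (RN_deriv lborel ext_measure x)" for x
  have k: "k \<in> borel_measurable borel" unfolding k_def by measurable
  have mass: "ext_mass A = (\<integral>x. k x * indicator A x \<partial>lborel)" "integrable lborel (\<lambda>x. k x * indicator A x)"
    if A: "A \<in> sets borel" for A
  proof -
    have ind: "(indicator A :: 'a \<Rightarrow> real) \<in> borel_measurable lborel" using A by simp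
    have "ext_mass A = measure ext_measure A"
      using emeasure_ext_measure[OF A] ext_mass_bounds[OF A] by (simp add: measure_def)
    also have "\<dots> = (\<integral>x. indicator A x \<partial>ext_measure)" using A sp by simp
    also have "\<dots> = (\<integral>x. k x * indicator A x \<partial>lborel)"
      using sigma_finite_measure.RN_deriv_integral[OF sigma_finite_lborel fm.sigma_finite_measure_axioms ac _ ind] by (simp add: k_def)
    finally show "ext_mass A = (\<integral>x. k x * indicator A x \<partial>lborel)" .
    have "integrable ext_measure (indicator A :: 'a \<Rightarrow> real)"
      using A by (intro integrable_real_indicator) (simp_all add: emeasure_ext_measure)
    then show "integrable lborel (\<lambda>x. k x * indicator A x)"
      using sigma_finite_measure.RN_deriv_integrable[OF sigma_finite_lborel fm.sigma_finite_measure_axioms ac _ ind] by (simp add: k_def)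
  qed
  have U: "U \<in> sets borel" by simp
  have "AE x in lborel. 0 \<le> 2 * C * indicator U x - k x * indicator U x"
  proof (rule AE_nonneg_if_set_integrals_nonneg)
    have iU: "integrable lborel (indicator U :: 'a \<Rightarrow> real)"
      using integrable_indicator_Int_U[of UNIV] by simp
    show "integrable lborel (\<lambda>x. 2 * C * indicator U x - k x * indicator U x)"
      using iU mass(2)[OF U] by auto
    fix A assume "A \<in> sets (lborel :: 'a measure)"
    then have A: "A \<inter> U \<in> sets borel" by auto
    have iA: "integrable lborel (indicator (A \<inter> U) :: 'a \<Rightarrow> real)"
      using integrable_indicator_Int_U[of A] \<open>A \<in> sets lborel\<close> by simp
    have "(\<integral>x. indicator A x * (2 * C * indicator U x - k x * indicator U x) \<partial>lborel)
        = (\<integral>x. 2 * C * indicator (A \<inter> U) x - k x * indicator (A \<inter> U) x \<partial>lborel)"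
      by (intro Bochner_Integration.integral_cong) (auto simp: indicator_def)
    also have "\<dots> = 2 * C * measure lborel (A \<inter> U) - ext_mass (A \<inter> U)"
      using mass[OF A] iA A by simp
    also have "\<dots> \<ge> 0" using ext_mass_bounds[OF A] by (simp add: Int_assoc)
    finally show "0 \<le> (\<integral>x. indicator A x * (2 * C * indicator U x - k x * indicator U x) \<partial>lborel)" .
  qed
  then have AE: "AE x in lborel. x \<in> U \<longrightarrow> k x \<le> 2 * C"
    by eventually_elim (auto simp: indicator_def split: if_splits)
  show thesis
  \<comment> \<open>Truncation turns a bound almost everywhere on U into a bound at every point.
    Inside U it alters the density on a null set only, whence the intersections with U in the
    integrals.\<close>
  proof (rule that[of "\<lambda>x. min (k x) (2 * C)"])
    show "(\<lambda>x. min (k x) (2 * C)) \<in> borel_measurable borel" using k by measurable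
    show "0 \<le> min (k x) (2 * C)" "min (k x) (2 * C) \<le> 2 * C" for x
      using C by (auto simp: k_def)
    fix A :: "'a set" assume A: "A \<in> sets borel"
    then have AU: "A \<inter> U \<in> sets borel" by auto
    have m: "(\<lambda>x. min (k x) (2 * C) * indicator (A \<inter> U) x) \<in> borel_measurable lborel"
      using k AU by measurable
    have ae: "AE x in lborel. k x * indicator (A \<inter> U) x = min (k x) (2 * C) * indicator (A \<inter> U) x"
      using AE by eventually_elim (auto simp: indicator_def)
    show "integrable lborel (\<lambda>x. min (k x) (2 * C) * indicator (A \<inter> U) x)"
      using integrable_cong_AE[THEN iffD1, OF _ m ae mass(2)[OF AU]] k AU by auto
    have "ext_mass A = ext_mass (A \<inter> U)" by (simp add: ext_mass_def Int_assoc)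
    also have "\<dots> = (\<integral>x. min (k x) (2 * C) * indicator (A \<inter> U) x \<partial>lborel)"
      unfolding mass(1)[OF AU] using k AU by (intro integral_cong_AE m ae) auto
    finally show "ext_mass A = (\<integral>x. min (k x) (2 * C) * indicator (A \<inter> U) x \<partial>lborel)" .
  qed
qed

lemma represented:
  obtains g where "g \<in> borel_measurable borel" "\<And>x. \<bar>g x\<bar> \<le> C"
    "\<And>u. u \<in> real_test U \<Longrightarrow> T u = (\<integral>x. g x * u x \<partial>lborel)"
proof -
  obtain k where k: "k \<in> borel_measurable borel" "\<And>x. 0 \<le> k x" "\<And>x. k x \<le> 2 * C"
    "\<And>A. A \<in> sets borel \<Longrightarrow> integrable lborel (\<lambda>x. k x * indicator (A \<inter> U) x)"
    "\<And>A. A \<in> sets borel \<Longrightarrow> ext_mass A = (\<integral>x. k x * indicator (A \<inter> U) x \<partial>lborel)"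
    using ext_density by blast
  \<comment> \<open>Taking back the multiple of Lebesgue measure contained in
    \<open>ext_mass\<close> centers the density: values in [0, 2C] become values in [-C, C].\<close>
  define g where "g x = k x - C" for x
  have g: "g \<in> borel_measurable borel" unfolding g_def using k(1) by measurable
  have gC: "\<bar>g x\<bar> \<le> C" for x using k(2)[of x] k(3)[of x] by (auto simp: g_def)
  have int: "integrable lborel (\<lambda>x. g x * (indicator U x * h x))" if "integrable lborel h" for h :: "'a \<Rightarrow> real"
  proof (rule Bochner_Integration.integrable_bound[where f="\<lambda>x. C * h x"])
    show "(\<lambda>x. g x * (indicator U x * h x)) \<in> borel_measurable lborel"
      using g that by measurable
    show "AE x in lborel. norm (g x * (indicator U x * h x)) \<le> norm (C * h x)"
      using gC C by (intro AE_I2) (auto simp: indicator_def abs_mult intro: mult_right_mono)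
  qed (use that in simp)
  have rep: "ext h = (\<integral>x. g x * (indicator U x * h x) \<partial>lborel)" if "integrable lborel h" for h
    using that
  proof (induction h rule: integrable_induct)
    case (base A c)
    then have A: "A \<in> sets borel" by simp
    have iA: "integrable lborel (indicator (A \<inter> U) :: 'a \<Rightarrow> real)"
      by (rule integrable_indicator_Int_U[OF A])
    have "ext (\<lambda>x. indicator A x *\<^sub>R c) = ext (\<lambda>x. c * indicator (A \<inter> U) x)"
      by (rule ext_cong) (auto simp: indicator_def)
    also have "\<dots> = c * ext (indicator (A \<inter> U))" by (rule ext_scale[OF iA])
    also have "\<dots> = c * ((\<integral>x. k x * indicator (A \<inter> U) x \<partial>lborel) - C * (\<integral>x. indicator (A \<inter> U) x \<partial>lborel))"
      using k(5)[OF A] A by (simp add: ext_mass_def)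
    also have "\<dots> = (\<integral>x. c * (k x * indicator (A \<inter> U) x - C * indicator (A \<inter> U) x) \<partial>lborel)"
      using k(4)[OF A] iA by simp
    also have "\<dots> = (\<integral>x. g x * (indicator U x * (indicator A x *\<^sub>R c)) \<partial>lborel)"
      by (intro Bochner_Integration.integral_cong) (auto simp: indicator_def g_def algebra_simps)
    finally show ?case .
  next
    case (add f h)
    then show ?case
      using ext_add[OF add.hyps] int by (simp add: distrib_left)
  next
    \<comment> \<open>Both sides are Lipschitz with constant C for the L^1 distance, so the identity
      survives the limit.\<close>
    case (lim f s)
    have sf: "integrable lborel (\<lambda>x. s i x - f x)" for i using lim.hyps by simp
    have ifs: "integrable lborel (\<lambda>x. -1 * f x)" using lim.hyps by simp
    have "(\<lambda>i. \<integral>x. \<bar>s i x - f x\<bar> \<partial>lborel) \<longlonglongrightarrow> 0"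
      by (rule L1_dominated_convergence) (use lim.hyps in auto)
    from tendsto_mult[OF tendsto_const[of C] this]
    have L: "(\<lambda>i. C * (\<integral>x. \<bar>s i x - f x\<bar> \<partial>lborel)) \<longlonglongrightarrow> 0" by simp
    have b: "C * (\<integral>x. indicator U x * \<bar>s i x - f x\<bar> \<partial>lborel) \<le> C * (\<integral>x. \<bar>s i x - f x\<bar> \<partial>lborel)" for i
      using sf[of i] C by (intro mult_left_mono integral_mono') (auto simp: indicator_def)
    have "(\<lambda>i. ext (s i) - ext f) \<longlonglongrightarrow> 0"
    proof (rule Lim_null_comparison[OF _ L], intro always_eventually allI)
      fix i
      have "ext (s i) - ext f = ext (\<lambda>x. s i x - f x)"
        using ext_add[OF lim.hyps(1)[of i] ifs] ext_scale[OF lim.hyps(4), of "-1"] by simp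
      then show "norm (ext (s i) - ext f) \<le> C * (\<integral>x. \<bar>s i x - f x\<bar> \<partial>lborel)"
        using ext_bound[OF sf[of i]] b[of i] by simp
    qed
    then have 1: "(\<lambda>i. ext (s i)) \<longlonglongrightarrow> ext f" by (rule LIM_zero_cancel)
    have "(\<lambda>i. (\<integral>x. g x * (indicator U x * s i x) \<partial>lborel) - (\<integral>x. g x * (indicator U x * f x) \<partial>lborel)) \<longlonglongrightarrow> 0"
    proof (rule Lim_null_comparison[OF _ L], intro always_eventually allI)
      fix i
      have "(\<integral>x. g x * (indicator U x * s i x) \<partial>lborel) - (\<integral>x. g x * (indicator U x * f x) \<partial>lborel)
          = (\<integral>x. g x * (indicator U x * (s i x - f x)) \<partial>lborel)"
        using int[OF lim.hyps(1)] int[OF lim.hyps(4)] by (simp add: right_diff_distrib)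
      also have "norm \<dots> \<le> (\<integral>x. C * \<bar>s i x - f x\<bar> \<partial>lborel)"
      proof (rule Bochner_Integration.integral_norm_bound_integral)
        show "integrable lborel (\<lambda>x. g x * (indicator U x * (s i x - f x)))" by (rule int[OF sf])
        show "norm (g x * (indicator U x * (s i x - f x))) \<le> C * \<bar>s i x - f x\<bar>" for x
          using gC[of x] C by (auto simp: indicator_def abs_mult intro: mult_right_mono)
      qed (use sf in simp)
      finally show "norm ((\<integral>x. g x * (indicator U x * s i x) \<partial>lborel) - (\<integral>x. g x * (indicator U x * f x) \<partial>lborel))
          \<le> C * (\<integral>x. \<bar>s i x - f x\<bar> \<partial>lborel)" by simp
    qed
    then have "(\<lambda>i. (\<integral>x. g x * (indicator U x * s i x) \<partial>lborel)) \<longlonglongrightarrow> (\<integral>x. g x * (indicator U x * f x) \<partial>lborel)"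
      by (rule LIM_zero_cancel)
    with 1 show ?case using lim.IH by (simp add: LIMSEQ_unique)
  qed
  show thesis
  proof (rule that[OF g gC])
    fix u assume u: "u \<in> real_test U"
    have "(\<lambda>x. g x * (indicator U x * u x)) = (\<lambda>x. g x * u x)"
      using real_test_eq_0[OF u] by (auto simp: indicator_def fun_eq_iff)
    then show "T u = (\<integral>x. g x * u x \<partial>lborel)"
      using rep[OF real_test_integrable[OF u]] ext_test[OF u] by metis
  qed
qed

end

section \<open>From bounds on test functions to bounds almost everywhere\<close>

text \<open>\<open>M\<close> is an a priori bound of any size that makes the integrals exist,
  \<open>C\<close> the bound visible to test functions. Density of test functions carries the latter
  over to indicators of Borel sets, and these detect where h or -h exceeds C.\<close>

lemma test_bound_imp_AE_bound:
  fixes h :: "'a::euclidean_space \<Rightarrow> real"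
  assumes U: "open U" "bounded U" and h: "h \<in> borel_measurable borel"
    and M: "AE x in lborel. \<bar>h x\<bar> \<le> M" and C: "0 \<le> C"
    and bound: "\<And>u. u \<in> real_test U \<Longrightarrow> (\<And>x. 0 \<le> u x) \<Longrightarrow>
      \<bar>\<integral>x. h x * u x \<partial>lborel\<bar> \<le> C * (\<integral>x. u x \<partial>lborel)"
  shows "AE x in lborel. x \<in> U \<longrightarrow> \<bar>h x\<bar> \<le> C"
proof -
  have int: "integrable lborel (\<lambda>x. h x * k x)" if k: "integrable lborel k" for k :: "'a \<Rightarrow> real"
  proof (rule Bochner_Integration.integrable_bound[where f="\<lambda>x. M * k x"])
    show "(\<lambda>x. h x * k x) \<in> borel_measurable lborel" using h k by measurable
    show "AE x in lborel. norm (h x * k x) \<le> norm (M * k x)"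
      using M by eventually_elim (auto simp: abs_mult intro!: mult_right_mono)
  qed (use k in simp)
  interpret bounded_test_functional U "\<lambda>u. \<integral>x. h x * u x \<partial>lborel" C
  proof
    fix u v assume uv: "u \<in> real_test U" "v \<in> real_test U"
    show "(\<integral>x. h x * (u x + v x) \<partial>lborel) = (\<integral>x. h x * u x \<partial>lborel) + (\<integral>x. h x * v x \<partial>lborel)"
      using int[OF real_test_integrable[OF uv(1)]] int[OF real_test_integrable[OF uv(2)]]
      by (simp add: distrib_left)
  next
    fix u and c :: real assume u: "u \<in> real_test U"
    have "(\<integral>x. h x * (c * u x) \<partial>lborel) = (\<integral>x. c * (h x * u x) \<partial>lborel)"
      by (simp add: mult.left_commute)
    then show "(\<integral>x. h x * (c * u x) \<partial>lborel) = c * (\<integral>x. h x * u x \<partial>lborel)" by simp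
  qed (use U C bound in auto)
  have set_bound: "\<bar>\<integral>x. h x * indicator (A \<inter> U) x \<partial>lborel\<bar> \<le> C * measure lborel (A \<inter> U)"
    if A: "A \<in> sets borel" for A
  proof -
    let ?k = "indicator (A \<inter> U) :: 'a \<Rightarrow> real"
    have k: "integrable lborel ?k" by (rule integrable_indicator_Int_U[OF A])
    have Uk: "indicator U x * ?k x = ?k x" for x by (auto simp: indicator_def)
    have "\<bar>\<integral>x. h x * ?k x \<partial>lborel\<bar> \<le> C * measure lborel (A \<inter> U) + e" if e: "e > 0" for e
    proof -
      \<comment> \<open>Replacing the indicator by u costs |M| times the distance in the integral
        with h and C times the distance in the bound; the 1 keeps the denominator positive.\<close>
      have "e / (\<bar>M\<bar> + C + 1) > 0" using e C by simp
      from approx[OF k this] obtain u where u: "u \<in> real_test U" "L1dist u ?k < e / (\<bar>M\<bar> + C + 1)" .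
      have d: "integrable lborel (\<lambda>x. u x - ?k x)"
        using real_test_integrable[OF u(1)] k by simp
      have dist: "L1dist u ?k = (\<integral>x. \<bar>u x - ?k x\<bar> \<partial>lborel)" by (simp add: L1dist_def Uk)
      have "\<bar>(\<integral>x. h x * u x \<partial>lborel) - (\<integral>x. h x * ?k x \<partial>lborel)\<bar> = \<bar>\<integral>x. h x * (u x - ?k x) \<partial>lborel\<bar>"
        using int[OF real_test_integrable[OF u(1)]] int[OF k] by (simp add: right_diff_distrib)
      also have "\<dots> \<le> (\<integral>x. \<bar>h x * (u x - ?k x)\<bar> \<partial>lborel)" by (rule integral_abs_bound)
      also have "\<dots> \<le> (\<integral>x. \<bar>M\<bar> * \<bar>u x - ?k x\<bar> \<partial>lborel)"
      proof (rule integral_mono_AE)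
        show "AE x in lborel. \<bar>h x * (u x - ?k x)\<bar> \<le> \<bar>M\<bar> * \<bar>u x - ?k x\<bar>"
          using M by eventually_elim (auto simp: abs_mult intro!: mult_right_mono)
      qed (use int[OF d] d in auto)
      also have "\<dots> = \<bar>M\<bar> * L1dist u ?k" by (simp add: dist)
      finally have 1: "\<bar>(\<integral>x. h x * u x \<partial>lborel) - (\<integral>x. h x * ?k x \<partial>lborel)\<bar> \<le> \<bar>M\<bar> * L1dist u ?k" .
      have "(\<integral>x. \<bar>u x\<bar> \<partial>lborel) \<le> (\<integral>x. \<bar>u x - ?k x\<bar> + ?k x \<partial>lborel)"
      proof (rule integral_mono)
        show "\<bar>u x\<bar> \<le> \<bar>u x - ?k x\<bar> + ?k x" for x
          by (cases "x \<in> A \<inter> U") auto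
      qed (use real_test_integrable[OF u(1)] d k in auto)
      also have "\<dots> = L1dist u ?k + measure lborel (A \<inter> U)"
        using d k A by (subst Bochner_Integration.integral_add) (auto simp: dist)
      finally have 2: "C * (\<integral>x. \<bar>u x\<bar> \<partial>lborel) \<le> C * (L1dist u ?k + measure lborel (A \<inter> U))"
        using C by (rule mult_left_mono)
      have "(\<bar>M\<bar> + C) * L1dist u ?k \<le> (\<bar>M\<bar> + C + 1) * L1dist u ?k"
        by (intro mult_right_mono) (auto simp: dist)
      also have "\<dots> \<le> e" using u(2) C by (simp add: field_simps)
      finally show ?thesis using 1 2 abs_bound[OF u(1)] by (simp add: algebra_simps)
    qed
    then show ?thesis by (rule field_le_epsilon)
  qed
  have iU: "integrable lborel (indicator U :: 'a \<Rightarrow> real)"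
    using integrable_indicator_Int_U[of UNIV] by simp
  \<comment> \<open>The sign c handles the upper and the lower bound together.\<close>
  have one: "AE x in lborel. 0 \<le> C * indicator U x - c * (h x * indicator U x)" if c: "\<bar>c\<bar> = 1" for c :: real
  proof (rule AE_nonneg_if_set_integrals_nonneg)
    show "integrable lborel (\<lambda>x. C * indicator U x - c * (h x * indicator U x))"
      using int[OF iU] iU by simp
    fix A assume "A \<in> sets (lborel :: 'a measure)"
    then have A: "A \<in> sets borel" by simp
    note k = integrable_indicator_Int_U[OF A]
    have "(\<integral>x. indicator A x * (C * indicator U x - c * (h x * indicator U x)) \<partial>lborel)
        = (\<integral>x. C * indicator (A \<inter> U) x - c * (h x * indicator (A \<inter> U) x) \<partial>lborel)"
      by (intro Bochner_Integration.integral_cong) (auto simp: indicator_def)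
    also have "\<dots> = C * measure lborel (A \<inter> U) - c * (\<integral>x. h x * indicator (A \<inter> U) x \<partial>lborel)"
      using int[OF k] k A by simp
    also have "\<dots> \<ge> 0"
    proof -
      have "c * (\<integral>x. h x * indicator (A \<inter> U) x \<partial>lborel) \<le> \<bar>\<integral>x. h x * indicator (A \<inter> U) x \<partial>lborel\<bar>"
        using abs_ge_self[of "c * (\<integral>x. h x * indicator (A \<inter> U) x \<partial>lborel)"] c by (simp add: abs_mult)
      then show ?thesis using set_bound[OF A] by simp
    qed
    finally show "0 \<le> (\<integral>x. indicator A x * (C * indicator U x - c * (h x * indicator U x)) \<partial>lborel)" .
  qed
  show ?thesis
    using one[of 1, simplified] one[of "-1", simplified]
    by eventually_elim (auto simp: indicator_def split: if_splits)
qed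

section \<open>Complex and real test functions, translation, linearity\<close>

lemma test_function_Ck: "\<phi> \<in> test_functions \<Longrightarrow> Ck n \<phi>"
  by (simp add: test_functions_def smooth_iff_Ck)

lemma test_functionI:
  assumes "\<And>n. Ck n \<phi>" "compact K" "\<And>x. x \<notin> K \<Longrightarrow> \<phi> x = 0"
  shows "\<phi> \<in> test_functions" "supp \<phi> \<subseteq> K"
proof -
  show s: "supp \<phi> \<subseteq> K"
    unfolding supp_def using assms(2,3) by (intro closure_minimal) (auto intro: compact_imp_closed)
  then have "compact (supp \<phi>)"
    using assms(2) compact_Int_closed[of K "supp \<phi>"] by (simp add: supp_def Int_absorb1)
  then show "\<phi> \<in> test_functions"
    using assms(1) by (simp add: test_functions_def smooth_iff_Ck)
qed

lemma test_function_eq_0: "x \<notin> supp \<phi> \<Longrightarrow> \<phi> x = 0"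
  unfolding supp_def using closure_subset[of "{x. \<phi> x \<noteq> 0}"] by auto

lemma real_test_of_real:
  assumes "u \<in> real_test U"
  shows "(\<lambda>x. complex_of_real (u x)) \<in> test_functions" "supp (\<lambda>x. complex_of_real (u x)) \<subseteq> U"
proof -
  obtain K where K: "compact K" "K \<subseteq> U" "\<And>x. x \<notin> K \<Longrightarrow> complex_of_real (u x) = 0"
    using assms by (auto simp: real_test_def)
  have "Ck n (\<lambda>x. complex_of_real (u x))" for n
    by (rule Ck_linear[OF bounded_linear_of_real real_test_Ck[OF assms]])
  from test_functionI[OF this K(1,3)] K(2)
  show "(\<lambda>x. complex_of_real (u x)) \<in> test_functions" "supp (\<lambda>x. complex_of_real (u x)) \<subseteq> U"
    by auto
qed

lemma test_function_parts:
  assumes "\<phi> \<in> test_functions" "supp \<phi> \<subseteq> U"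
  shows "(\<lambda>x. Re (\<phi> x)) \<in> real_test U" "(\<lambda>x. Im (\<phi> x)) \<in> real_test U"
proof -
  have "compact (supp \<phi>)" using assms by (simp add: test_functions_def)
  moreover have "Ck n (\<lambda>x. Re (\<phi> x))" "Ck n (\<lambda>x. Im (\<phi> x))" for n
    by (rule Ck_linear[OF bounded_linear_Re test_function_Ck[OF assms(1)]],
        rule Ck_linear[OF bounded_linear_Im test_function_Ck[OF assms(1)]])
  ultimately show "(\<lambda>x. Re (\<phi> x)) \<in> real_test U" "(\<lambda>x. Im (\<phi> x)) \<in> real_test U"
    using assms(2) by (auto intro!: real_testI[of _ "supp \<phi>"] simp: test_function_eq_0)
qed

lemma real_test_translate:
  assumes "u \<in> real_test (ball b r)" shows "(\<lambda>x. u (x - a)) \<in> real_test (ball (b + a) r)"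
proof -
  obtain K where K: "compact K" "K \<subseteq> ball b r" "\<And>x. x \<notin> K \<Longrightarrow> u x = 0"
    using assms by (auto simp: real_test_def)
  have "compact ((+) a ` K)" using K(1) by (rule compact_translation)
  moreover have "(+) a ` K \<subseteq> ball (b + a) r"
    using K(2) by (auto simp: dist_norm algebra_simps subset_eq)
  moreover have "u (x - a) = 0" if "x \<notin> (+) a ` K" for x
    using that K(3)[of "x - a"] by force
  ultimately show ?thesis
    by (intro real_testI Ck_translate real_test_Ck[OF assms])
qed

lemma integral_lborel_translate:
  fixes u :: "'a::euclidean_space \<Rightarrow> real"
  assumes "u \<in> borel_measurable borel"
  shows "(\<integral>x. u (x - a) \<partial>lborel) = (\<integral>x. u x \<partial>lborel)"
proof -
  have "(\<integral>x. u x \<partial>lborel) = (\<integral>x. u x \<partial>distr lborel borel ((+) (- a)))"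
    by (simp add: lborel_distr_plus)
  also have "\<dots> = (\<integral>x. u (- a + x) \<partial>lborel)"
    using assms by (intro integral_distr) auto
  finally show ?thesis by simp
qed

lemma distribution_add:
  "distribution f \<Longrightarrow> u \<in> real_test U \<Longrightarrow> v \<in> real_test U \<Longrightarrow>
    f (\<lambda>x. of_real (u x + v x)) = f (\<lambda>x. of_real (u x)) + f (\<lambda>x. of_real (v x))"
  using real_test_of_real(1)[of u U] real_test_of_real(1)[of v U] by (simp add: distribution_def)

lemma distribution_scale:
  "distribution f \<Longrightarrow> u \<in> real_test U \<Longrightarrow> f (\<lambda>x. of_real (c * u x)) = of_real c * f (\<lambda>x. of_real (u x))"
  using real_test_of_real(1)[of u U] by (simp add: distribution_def)

text \<open>By complex linearity f is determined by its values on real test functions, to which the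
  extension argument applies.\<close>

lemma distribution_Re_Im:
  assumes "distribution f" "\<phi> \<in> test_functions"
  shows "f \<phi> = f (\<lambda>x. of_real (Re (\<phi> x))) + \<i> * f (\<lambda>x. of_real (Im (\<phi> x)))"
proof -
  note t = test_function_parts[OF assms(2) subset_UNIV, THEN real_test_of_real(1)]
  have it: "(\<lambda>x. \<i> * of_real (Im (\<phi> x))) \<in> test_functions"
  proof (rule test_functionI(1))
    show "compact (supp \<phi>)" using assms(2) by (simp add: test_functions_def)
    show "Ck n (\<lambda>x. \<i> * of_real (Im (\<phi> x)))" for n
      using test_function_Ck[OF t(2)] by (rule Ck_cmult)
  qed (simp add: test_function_eq_0)
  have "f \<phi> = f (\<lambda>x. of_real (Re (\<phi> x)) + \<i> * of_real (Im (\<phi> x)))"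
    by (simp add: complex_eq[symmetric])
  also have "\<dots> = f (\<lambda>x. of_real (Re (\<phi> x))) + f (\<lambda>x. \<i> * of_real (Im (\<phi> x)))"
    using assms(1) t it by (simp add: distribution_def)
  also have "f (\<lambda>x. \<i> * of_real (Im (\<phi> x))) = \<i> * f (\<lambda>x. of_real (Im (\<phi> x)))"
    using assms(1) t by (simp add: distribution_def)
  finally show ?thesis .
qed

subsection \<open>Distributions given by bounded functions\<close>

lemma Linf_iff:
  "g \<in> Linf B \<longleftrightarrow> g \<in> borel_measurable (lebesgue_on B) \<and> (\<exists>M. AE x in lebesgue_on B. norm (g x) \<le> M)"
proof safe
  assume g: "g \<in> Linf B"
  then show "g \<in> borel_measurable (lebesgue_on B)" by (simp add: Linf_def)
  \<comment> \<open>On a null set the essential supremum is -\<infinity>, and then any M will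
    do.\<close>
  obtain M where "Linf_norm B g \<le> ereal M"
    using g by (cases "Linf_norm B g") (auto simp: Linf_def)
  moreover have "AE x in lebesgue_on B. ereal (norm (g x)) \<le> Linf_norm B g"
    unfolding Linf_norm_def by (rule esssup_AE)
  ultimately have "AE x in lebesgue_on B. norm (g x) \<le> M"
    by (auto elim!: eventually_mono dest: order_trans)
  then show "\<exists>M. AE x in lebesgue_on B. norm (g x) \<le> M" ..
next
  fix M assume g: "g \<in> borel_measurable (lebesgue_on B)" "AE x in lebesgue_on B. norm (g x) \<le> M"
  have "Linf_norm B g \<le> ereal M"
    unfolding Linf_norm_def using g by (intro esssup_I) auto
  then show "g \<in> Linf B" using g by (auto simp: Linf_def)
qed

lemma LinfE:
  assumes "g \<in> Linf B"
  obtains M where "0 \<le> M" "AE x in lebesgue_on B. norm (g x) \<le> M"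
proof -
  obtain M where "AE x in lebesgue_on B. norm (g x) \<le> M" using assms by (auto simp: Linf_iff)
  then have "AE x in lebesgue_on B. norm (g x) \<le> max M 0" by eventually_elim auto
  then show thesis by (intro that[of "max M 0"]) auto
qed

lemma Linf_subset:
  assumes "g \<in> Linf B" "A \<subseteq> B" "A \<in> sets lebesgue" "B \<in> sets lebesgue" shows "g \<in> Linf A"
proof -
  obtain M where "AE x in lebesgue_on B. norm (g x) \<le> M" using assms by (auto simp: Linf_iff)
  then have "AE x in lebesgue. x \<in> B \<longrightarrow> norm (g x) \<le> M"
    using assms(4) by (simp add: AE_restrict_space_iff)
  then have "AE x in lebesgue_on A. norm (g x) \<le> M"
    using assms(2,3) by (auto simp: AE_restrict_space_iff elim!: eventually_mono)
  moreover have "g \<in> borel_measurable (lebesgue_on A)"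
    using assms(1) by (intro measurable_restrict_mono[OF _ assms(2)]) (simp add: Linf_iff)
  ultimately show ?thesis by (auto simp: Linf_iff)
qed

lemma integral_lebesgue_on_mult:
  fixes g \<phi> :: "'a::euclidean_space \<Rightarrow> complex"
  assumes "B \<in> sets lebesgue"
  shows "(LINT x|lebesgue_on B. g x * \<phi> x) = (LINT x|lebesgue. indicator B x *\<^sub>R (g x * \<phi> x))"
  using assms by (intro integral_restrict_space) simp

lemma represents_on_subset:
  assumes "represents_on g f B" "A \<subseteq> B" "A \<in> sets lebesgue" "B \<in> sets lebesgue"
  shows "represents_on g f A"
  unfolding represents_on_def
proof (intro ballI impI)
  fix \<phi> assume \<phi>: "\<phi> \<in> test_functions" "supp \<phi> \<subseteq> A"
  then have "f \<phi> = (LINT x|lebesgue_on B. g x * \<phi> x)"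
    using assms(1,2) unfolding represents_on_def by blast
  also have "\<dots> = (LINT x|lebesgue_on A. g x * \<phi> x)"
    unfolding integral_lebesgue_on_mult[OF assms(3)] integral_lebesgue_on_mult[OF assms(4)]
  proof (rule Bochner_Integration.integral_cong[OF refl])
    show "indicator B x *\<^sub>R (g x * \<phi> x) = indicator A x *\<^sub>R (g x * \<phi> x)" for x
      using test_function_eq_0[of x \<phi>] \<phi>(2) assms(2) by (auto simp: indicator_def)
  qed
  finally show "f \<phi> = (LINT x|lebesgue_on A. g x * \<phi> x)" .
qed

lemma restriction_works:
  assumes "restricts_to_Linf f B"
  shows "restriction f B \<in> Linf B" "represents_on (restriction f B) f B"
proof -
  have "\<exists>g. g \<in> Linf B \<and> represents_on g f B" using assms by (auto simp: restricts_to_Linf_def)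
  from someI_ex[OF this] show "restriction f B \<in> Linf B" "represents_on (restriction f B) f B"
    by (simp_all add: restriction_def)
qed

text \<open>Membership on one ball guarantees that on every smaller ball the choice in
  \<open>restriction\<close> is made among genuine representatives.\<close>

lemma restricts_to_Linf_subset:
  assumes "restricts_to_Linf f B" "A \<subseteq> B" "A \<in> sets lebesgue" "B \<in> sets lebesgue"
  shows "restricts_to_Linf f A"
  using assms Linf_subset represents_on_subset unfolding restricts_to_Linf_def by blast

lemma represented_diff:
  assumes U: "U \<in> sets lebesgue" and g: "g \<in> borel_measurable (lebesgue_on U)"
    and M: "AE x in lebesgue_on U. norm (g x - c) \<le> M"
    and rep: "represents_on g f U" and u: "u \<in> real_test U"
  shows "integrable lebesgue (\<lambda>x. indicator U x *\<^sub>R (g x - c) * of_real (u x))" (is ?I)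
    and "f (\<lambda>x. of_real (u x)) - c * of_real (\<integral>x. u x \<partial>lborel) =
      (LINT x|lebesgue. indicator U x *\<^sub>R (g x - c) * of_real (u x))" (is ?E)
proof -
  have iu: "integrable lebesgue u"
    using real_test_integrable[OF u] real_test_borel[OF u] by (simp add: integrable_completion)
  have ic: "integrable lebesgue (\<lambda>x. c * complex_of_real (u x))"
    using iu by simp
  have gm: "(\<lambda>x. indicator U x *\<^sub>R (g x - c)) \<in> borel_measurable lebesgue"
    using g U by (subst borel_measurable_restrict_space_iff[symmetric]) auto
  have AE: "AE x in lebesgue. x \<in> U \<longrightarrow> norm (g x - c) \<le> M"
    using M U by (simp add: AE_restrict_space_iff)
  show ?I
  proof (rule Bochner_Integration.integrable_bound[where f="\<lambda>x. M * u x"])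
    show "(\<lambda>x. indicator U x *\<^sub>R (g x - c) * of_real (u x)) \<in> borel_measurable lebesgue"
      using gm borel_measurable_integrable[OF iu] by measurable
    show "AE x in lebesgue. norm (indicator U x *\<^sub>R (g x - c) * of_real (u x)) \<le> norm (M * u x)"
      using AE by eventually_elim (auto simp: norm_mult abs_mult indicator_def intro!: mult_right_mono)
  qed (use iu in simp)
  have eq: "indicator U x *\<^sub>R (g x * of_real (u x)) =
      indicator U x *\<^sub>R (g x - c) * of_real (u x) + c * of_real (u x)" for x
    using real_test_eq_0[OF u, of x] by (auto simp: indicator_def algebra_simps)
  have "f (\<lambda>x. of_real (u x)) = (LINT x|lebesgue. indicator U x *\<^sub>R (g x * of_real (u x)))"
    using rep real_test_of_real[OF u] integral_lebesgue_on_mult[OF U] unfolding represents_on_def by metis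
  also have "\<dots> = (LINT x|lebesgue. indicator U x *\<^sub>R (g x - c) * of_real (u x)) + (LINT x|lebesgue. c * of_real (u x))"
    unfolding eq by (rule Bochner_Integration.integral_add[OF \<open>?I\<close> ic])
  also have "(LINT x|lebesgue. c * of_real (u x)) = c * of_real (\<integral>x. u x \<partial>lborel)"
    using real_test_borel[OF u] by (simp add: integral_completion)
  finally show ?E by simp
qed

lemma represented_diff_bound:
  assumes U: "U \<in> sets lebesgue" and g: "g \<in> borel_measurable (lebesgue_on U)"
    and M: "AE x in lebesgue_on U. norm (g x - c) \<le> M"
    and rep: "represents_on g f U" and u: "u \<in> real_test U" and nonneg: "\<And>x. 0 \<le> u x"
    and M0: "0 \<le> M"
  shows "norm (f (\<lambda>x. of_real (u x)) - c * of_real (\<integral>x. u x \<partial>lborel)) \<le> M * (\<integral>x. u x \<partial>lborel)"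
proof -
  note r = represented_diff[OF U g M rep u]
  have iu: "integrable lebesgue u"
    using real_test_integrable[OF u] real_test_borel[OF u] by (simp add: integrable_completion)
  have AE: "AE x in lebesgue. x \<in> U \<longrightarrow> norm (g x - c) \<le> M"
    using M U by (simp add: AE_restrict_space_iff)
  have "norm (f (\<lambda>x. of_real (u x)) - c * of_real (\<integral>x. u x \<partial>lborel))
      \<le> (LINT x|lebesgue. norm (indicator U x *\<^sub>R (g x - c) * of_real (u x)))"
    unfolding r(2) by (rule integral_norm_bound)
  also have "\<dots> \<le> (LINT x|lebesgue. M * u x)"
  proof (rule integral_mono_AE)
    show "AE x in lebesgue. norm (indicator U x *\<^sub>R (g x - c) * of_real (u x)) \<le> M * u x"
      using AE by eventually_elim
        (use nonneg M0 in \<open>auto simp: norm_mult abs_mult indicator_def intro!: mult_right_mono\<close>)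
    show "integrable lebesgue (\<lambda>x. norm (indicator U x *\<^sub>R (g x - c) * complex_of_real (u x)))"
      by (rule integrable_norm[OF r(1)])
  qed (use iu in simp)
  also have "\<dots> = M * (\<integral>x. u x \<partial>lborel)"
    using real_test_borel[OF u] by (simp add: integral_completion)
  finally show ?thesis .
qed

text \<open>This gives closeness to c for whichever representative was chosen. Real and imaginary
  parts obey the bound C separately; adding them gives 2C.\<close>

lemma represented_bound_converse:
  assumes U: "open U" "bounded U" and g: "g \<in> Linf U" and rep: "represents_on g f U" and C: "0 \<le> C"
    and bound: "\<And>u. u \<in> real_test U \<Longrightarrow> (\<And>x. 0 \<le> u x) \<Longrightarrow>
      norm (f (\<lambda>x. of_real (u x)) - c * of_real (\<integral>x. u x \<partial>lborel)) \<le> C * (\<integral>x. u x \<partial>lborel)"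
  shows "AE x in lebesgue_on U. norm (g x - c) \<le> 2 * C"
proof -
  have Us: "U \<in> sets lebesgue" using U by simp
  have gm: "g \<in> borel_measurable (lebesgue_on U)" using g by (simp add: Linf_iff)
  obtain M0 where M0: "AE x in lebesgue_on U. norm (g x) \<le> M0" using g by (auto simp: Linf_iff)
  define M where "M = M0 + norm c"
  have M: "AE x in lebesgue_on U. norm (g x - c) \<le> M"
    using M0
  proof eventually_elim
    case (elim x) then show ?case using norm_triangle_ineq4[of "g x" c] by (simp add: M_def)
  qed
  have AEM: "AE x in lebesgue. x \<in> U \<longrightarrow> norm (g x - c) \<le> M"
    using M Us by (simp add: AE_restrict_space_iff)
  have hm: "(\<lambda>x. indicator U x *\<^sub>R (g x - c)) \<in> borel_measurable lebesgue"
    using gm Us by (subst borel_measurable_restrict_space_iff[symmetric]) auto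
  have part: "AE x in lborel. x \<in> U \<longrightarrow> \<bar>L (g x - c)\<bar> \<le> C"
    if L: "bounded_linear L" "\<And>z. \<bar>L z\<bar> \<le> norm z" "\<And>z r. L (z * of_real r) = L z * r"
    for L :: "complex \<Rightarrow> real"
  proof -
    let ?h = "\<lambda>x. L (indicator U x *\<^sub>R (g x - c))"
    have "?h \<in> borel_measurable lebesgue"
      using measurable_comp[OF hm borel_measurable_continuous_onI[OF linear_continuous_on[OF L(1)]]]
      by (simp add: comp_def)
    \<comment> \<open>The representative is only Lebesgue measurable, so a Borel function equal to
      it almost everywhere takes its place.\<close>
    then obtain h where h: "h \<in> borel_measurable lborel" "AE x in lborel. ?h x = h x"
      using completion_ex_borel_measurable_real by blast
    have h': "AE x in lebesgue. ?h x = h x" using h(2) by (rule AE_completion)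
    have L0: "L 0 = 0" using linear_0[OF bounded_linear.linear[OF L(1)]] .
    have "AE x in lebesgue. \<bar>h x\<bar> \<le> \<bar>M\<bar>"
      using AEM h'
    proof eventually_elim
      case (elim x)
      have "\<bar>h x\<bar> \<le> norm (indicator U x *\<^sub>R (g x - c))" using L(2) elim(2) by metis
      also have "\<dots> \<le> \<bar>M\<bar>" using elim(1) by (auto simp: indicator_def)
      finally show ?case .
    qed
    then have hM: "AE x in lborel. \<bar>h x\<bar> \<le> \<bar>M\<bar>" by (simp add: AE_completion_iff)
    have "AE x in lborel. x \<in> U \<longrightarrow> \<bar>h x\<bar> \<le> C"
    proof (rule test_bound_imp_AE_bound[OF U _ hM C])
      show "h \<in> borel_measurable borel" using h(1) by simp
      fix u :: "'a \<Rightarrow> real" assume u: "u \<in> real_test U" "\<And>x. 0 \<le> u x"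
      note r = represented_diff[OF Us gm M rep u(1)]
      have "h \<in> borel_measurable borel" using h(1) by simp
      then have "(\<lambda>x. h x * u x) \<in> borel_measurable borel"
        using real_test_borel[OF u(1)] by (rule borel_measurable_times)
      then have hu: "(\<lambda>x. h x * u x) \<in> borel_measurable lborel" by simp
      have "(\<integral>x. h x * u x \<partial>lborel) = (LINT x|lebesgue. h x * u x)"
        by (rule integral_completion[OF hu, symmetric])
      also have "\<dots> = (LINT x|lebesgue. L (indicator U x *\<^sub>R (g x - c) * of_real (u x)))"
      proof (rule integral_cong_AE)
        show "(\<lambda>x. h x * u x) \<in> borel_measurable lebesgue"
          by (rule measurable_completion[OF hu])
        show "(\<lambda>x. L (indicator U x *\<^sub>R (g x - c) * of_real (u x))) \<in> borel_measurable lebesgue"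
          using integrable_bounded_linear[OF L(1) r(1)] by (rule borel_measurable_integrable)
        show "AE x in lebesgue. h x * u x = L (indicator U x *\<^sub>R (g x - c) * of_real (u x))"
          using h' by eventually_elim (simp only: L(3))
      qed
      also have "\<dots> = L (f (\<lambda>x. of_real (u x)) - c * of_real (\<integral>x. u x \<partial>lborel))"
        unfolding r(2) by (rule integral_bounded_linear[OF L(1) r(1)])
      also have "\<bar>\<dots>\<bar> \<le> C * (\<integral>x. u x \<partial>lborel)"
        using L(2) bound[OF u] by (rule order_trans)
      finally show "\<bar>\<integral>x. h x * u x \<partial>lborel\<bar> \<le> C * (\<integral>x. u x \<partial>lborel)" .
    qed
    with h(2) show ?thesis by eventually_elim auto
  qed
  have "AE x in lborel. x \<in> U \<longrightarrow> \<bar>Re (g x - c)\<bar> \<le> C"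
    by (rule part[OF bounded_linear_Re abs_Re_le_cmod]) simp
  moreover have "AE x in lborel. x \<in> U \<longrightarrow> \<bar>Im (g x - c)\<bar> \<le> C"
    by (rule part[OF bounded_linear_Im abs_Im_le_cmod]) simp
  ultimately have "AE x in lborel. x \<in> U \<longrightarrow> norm (g x - c) \<le> 2 * C"
  proof eventually_elim
    case (elim x) then show ?case using cmod_le[of "g x - c"] by auto
  qed
  from AE_completion[OF this] show ?thesis using Us by (simp add: AE_restrict_space_iff)
qed

text \<open>The bound concerns f - c, so the density is built for the real and imaginary parts of
  this difference, and c is added back at the end.\<close>

lemma restricts_to_LinfI:
  assumes U: "open U" "bounded U" and f: "distribution f" and C: "0 \<le> C"
    and bound: "\<And>u. u \<in> real_test U \<Longrightarrow> (\<And>x. 0 \<le> u x) \<Longrightarrow>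
      norm (f (\<lambda>x. of_real (u x)) - c * of_real (\<integral>x. u x \<partial>lborel)) \<le> C * (\<integral>x. u x \<partial>lborel)"
  shows "restricts_to_Linf f U"
proof -
  let ?F = "\<lambda>u. f (\<lambda>x. of_real (u x)) - c * of_real (\<integral>x. u x \<partial>lborel)"
  have Fadd: "?F (\<lambda>x. u x + v x) = ?F u + ?F v" if "u \<in> real_test U" "v \<in> real_test U" for u v
    using distribution_add[OF f that] real_test_integrable[OF that(1)] real_test_integrable[OF that(2)]
    by (simp add: algebra_simps)
  have Fscale: "?F (\<lambda>x. r * u x) = of_real r * ?F u" if "u \<in> real_test U" for u r
    using distribution_scale[OF f that, of r] by (simp add: algebra_simps)
  have part: "bounded_test_functional U (\<lambda>u. L (?F u)) C"
    if L: "\<And>z w. L (z + w) = L z + L w" "\<And>z. \<bar>L z\<bar> \<le> norm z" "\<And>z r. L (of_real r * z) = r * L z"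
    for L :: "complex \<Rightarrow> real"
  proof
    fix u v assume uv: "u \<in> real_test U" "v \<in> real_test U"
    show "L (?F (\<lambda>x. u x + v x)) = L (?F u) + L (?F v)" unfolding Fadd[OF uv] L(1) ..
  next
    fix u r assume u: "u \<in> real_test U"
    show "L (?F (\<lambda>x. r * u x)) = r * L (?F u)" unfolding Fscale[OF u] L(3) ..
  next
    fix u :: "'a \<Rightarrow> real" assume u: "u \<in> real_test U" "\<And>x. 0 \<le> u x"
    show "\<bar>L (?F u)\<bar> \<le> C * (\<integral>x. u x \<partial>lborel)"
      using L(2) bound[OF u] by (rule order_trans)
  qed (use U C in auto)
  interpret re: bounded_test_functional U "\<lambda>u. Re (?F u)" C
    by (rule part) (auto simp: abs_Re_le_cmod)
  interpret im: bounded_test_functional U "\<lambda>u. Im (?F u)" C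
    by (rule part) (auto simp: abs_Im_le_cmod)
  obtain a where a: "a \<in> borel_measurable borel" "\<And>x. \<bar>a x\<bar> \<le> C"
    "\<And>u. u \<in> real_test U \<Longrightarrow> Re (?F u) = (\<integral>x. a x * u x \<partial>lborel)"
    using re.represented by blast
  obtain b where b: "b \<in> borel_measurable borel" "\<And>x. \<bar>b x\<bar> \<le> C"
    "\<And>u. u \<in> real_test U \<Longrightarrow> Im (?F u) = (\<integral>x. b x * u x \<partial>lborel)"
    using im.represented by blast
  define g where "g x = c + Complex (a x) (b x)" for x
  have gC: "g x = c + (of_real (a x) + \<i> * of_real (b x))" for x
    by (simp add: g_def complex_eq_iff)
  have g: "g \<in> borel_measurable borel" unfolding gC using a(1) b(1) by measurable
  have bd: "norm (g x) \<le> norm c + 2 * C" for x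
  proof -
    have "norm (g x) \<le> norm c + norm (Complex (a x) (b x))" unfolding g_def by (rule norm_triangle_ineq)
    also have "norm (Complex (a x) (b x)) \<le> \<bar>a x\<bar> + \<bar>b x\<bar>" using cmod_le[of "Complex (a x) (b x)"] by simp
    finally show ?thesis using a(2)[of x] b(2)[of x] by simp
  qed
  have Us: "U \<in> sets lebesgue" using U by simp
  have int: "integrable lborel (\<lambda>x. k x * u x)"
    if "k \<in> borel_measurable borel" "\<And>x. \<bar>k x\<bar> \<le> C" "u \<in> real_test U" for k u :: "'a \<Rightarrow> real"
  proof (rule Bochner_Integration.integrable_bound[where f="\<lambda>x. C * u x"])
    show "(\<lambda>x. k x * u x) \<in> borel_measurable lborel" using that(1) real_test_borel[OF that(3)] by measurable
    show "AE x in lborel. norm (k x * u x) \<le> norm (C * u x)"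
      using that(2) C by (intro AE_I2) (auto simp: abs_mult intro!: mult_right_mono)
  qed (use real_test_integrable[OF that(3)] in simp)
  have eqF: "f (\<lambda>x. of_real (u x)) = (\<integral>x. g x * of_real (u x) \<partial>lborel)"
      and intg: "integrable lborel (\<lambda>x. g x * complex_of_real (u x))" if u: "u \<in> real_test U" for u
  proof -
    have iu: "integrable lborel (\<lambda>x. c * complex_of_real (u x))"
      and ia: "integrable lborel (\<lambda>x. complex_of_real (a x * u x))"
      and ib: "integrable lborel (\<lambda>x. \<i> * complex_of_real (b x * u x))"
      using real_test_integrable[OF u] int[OF a(1,2) u] int[OF b(1,2) u] by (auto simp del: of_real_mult)
    have g_eq: "g x * of_real (u x) = c * of_real (u x) + (of_real (a x * u x) + \<i> * of_real (b x * u x))" for x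
      by (simp add: gC algebra_simps)
    show "integrable lborel (\<lambda>x. g x * complex_of_real (u x))"
      unfolding g_eq using iu ia ib by (intro Bochner_Integration.integrable_add)
    have "?F u = of_real (\<integral>x. a x * u x \<partial>lborel) + \<i> * of_real (\<integral>x. b x * u x \<partial>lborel)"
      unfolding a(3)[OF u, symmetric] b(3)[OF u, symmetric] by (rule complex_eq)
    then have "f (\<lambda>x. of_real (u x)) = c * of_real (\<integral>x. u x \<partial>lborel) +
        (of_real (\<integral>x. a x * u x \<partial>lborel) + \<i> * of_real (\<integral>x. b x * u x \<partial>lborel))"
      by (simp add: algebra_simps)
    also have "\<dots> = (\<integral>x. g x * of_real (u x) \<partial>lborel)"
      unfolding g_eq using iu ia ib
      by (simp del: of_real_mult)
    finally show "f (\<lambda>x. of_real (u x)) = (\<integral>x. g x * of_real (u x) \<partial>lborel)" .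
  qed
  have "represents_on g f U"
    unfolding represents_on_def
  proof (intro ballI impI)
    fix \<phi> assume \<phi>: "\<phi> \<in> test_functions" "supp \<phi> \<subseteq> U"
    note p = test_function_parts[OF \<phi>]
    have g\<phi>: "g x * \<phi> x = g x * of_real (Re (\<phi> x)) + \<i> * (g x * of_real (Im (\<phi> x)))" for x
      by (subst complex_eq[of "\<phi> x"]) (simp add: distrib_left mult.left_commute)
    have i2: "integrable lborel (\<lambda>x. \<i> * (g x * complex_of_real (Im (\<phi> x))))"
      using intg[OF p(2)] by simp
    have "f \<phi> = (\<integral>x. g x * of_real (Re (\<phi> x)) \<partial>lborel) + \<i> * (\<integral>x. g x * of_real (Im (\<phi> x)) \<partial>lborel)"
      using distribution_Re_Im[OF f \<phi>(1)] eqF[OF p(1)] eqF[OF p(2)] by simp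
    also have "\<dots> = (\<integral>x. g x * \<phi> x \<partial>lborel)"
      unfolding g\<phi> by (subst Bochner_Integration.integral_add[OF intg[OF p(1)] i2]) simp
    also have "\<dots> = (LINT x|lebesgue. g x * \<phi> x)"
    proof (rule integral_completion[symmetric])
      have "integrable lborel (\<lambda>x. g x * \<phi> x)"
        unfolding g\<phi> by (rule Bochner_Integration.integrable_add[OF intg[OF p(1)] i2])
      then show "(\<lambda>x. g x * \<phi> x) \<in> borel_measurable lborel" by (rule borel_measurable_integrable)
    qed
    also have "\<dots> = (LINT x|lebesgue. indicator U x *\<^sub>R (g x * \<phi> x))"
      using test_function_eq_0[of _ \<phi>] \<phi>(2)
      by (intro Bochner_Integration.integral_cong) (auto simp: indicator_def)
    finally show "f \<phi> = (LINT x|lebesgue_on U. g x * \<phi> x)"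
      unfolding integral_lebesgue_on_mult[OF Us] .
  qed
  moreover have "g \<in> Linf U"
    unfolding Linf_iff
  proof
    show "g \<in> borel_measurable (lebesgue_on U)"
      using g by (intro measurable_restrict_space1 measurable_completion) simp
    show "\<exists>M. AE x in lebesgue_on U. norm (g x) \<le> M"
      using bd by (intro exI[of _ "norm c + 2 * C"]) auto
  qed
  ultimately show ?thesis by (auto simp: restricts_to_Linf_def)
qed

subsection \<open>Delta sequences\<close>

lemma test_function_integrable:
  assumes "\<phi> \<in> test_functions" shows "integrable lborel \<phi>"
proof -
  have cont: "continuous_on S \<phi>" for S by (rule Ck_imp_continuous[OF test_function_Ck[OF assms]])
  have "compact (supp \<phi>)" using assms by (simp add: test_functions_def)
  from borel_integrable_compact[OF this cont]
  have "integrable lborel (\<lambda>x. indicator (supp \<phi>) x *\<^sub>R \<phi> x)" .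
  also have "(\<lambda>x. indicator (supp \<phi>) x *\<^sub>R \<phi> x) = \<phi>"
    using test_function_eq_0[of _ \<phi>] by (auto simp: indicator_def fun_eq_iff)
  finally show ?thesis .
qed

lemma real_test_mult_test_function_integrable:
  assumes "u \<in> real_test U" "\<psi> \<in> test_functions"
  shows "integrable lborel (\<lambda>x. complex_of_real (u x) * \<psi> x)"
proof (rule test_function_integrable)
  show "(\<lambda>x. complex_of_real (u x) * \<psi> x) \<in> test_functions"
  proof (rule test_functionI(1))
    show "compact (supp \<psi>)" using assms(2) by (simp add: test_functions_def)
    show "Ck n (\<lambda>x. complex_of_real (u x) * \<psi> x)" for n
      by (rule Ck_mult[OF Ck_linear[OF bounded_linear_of_real real_test_Ck[OF assms(1)]] test_function_Ck[OF assms(2)]])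
  qed (simp add: test_function_eq_0)
qed

text \<open>Unit mass turns the error into an average of \<psi>(x) - \<psi>(0) over a ball of radius
  \<open>r n\<close>, where continuity at 0 makes it small.\<close>

lemma delta_sequenceI:
  fixes v :: "nat \<Rightarrow> 'a::euclidean_space \<Rightarrow> real"
  assumes v: "\<And>n. v n \<in> real_test (ball 0 (r n))" and r: "r \<longlonglongrightarrow> 0"
    and nonneg: "\<And>n x. 0 \<le> v n x" and one: "\<And>n. (\<integral>x. v n x \<partial>lborel) = 1"
  shows "delta_sequence (\<lambda>n x. complex_of_real (v n x))"
  unfolding delta_sequence_def
proof (intro conjI allI ballI)
  show "(\<lambda>x. complex_of_real (v n x)) \<in> test_functions" for n by (rule real_test_of_real[OF v])
  fix \<psi> :: "'a \<Rightarrow> complex" assume \<psi>: "\<psi> \<in> test_functions"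
  have cont: "continuous_on UNIV \<psi>" by (rule Ck_imp_continuous[OF test_function_Ck[OF \<psi>]])
  show "(\<lambda>n. LINT x|lebesgue. complex_of_real (v n x) * \<psi> x) \<longlonglongrightarrow> \<psi> 0"
  proof (rule LIMSEQ_I)
    fix e :: real assume e: "0 < e"
    obtain d where d: "d > 0" "\<And>x. dist x 0 < d \<Longrightarrow> dist (\<psi> x) (\<psi> 0) < e / 2"
      using cont e unfolding continuous_on_iff by (metis UNIV_I half_gt_zero)
    obtain N where N: "\<And>n. n \<ge> N \<Longrightarrow> r n < d"
      using order_tendstoD(2)[OF r d(1)] by (auto simp: eventually_sequentially)
    have "norm ((LINT x|lebesgue. complex_of_real (v n x) * \<psi> x) - \<psi> 0) < e" if n: "n \<ge> N" for n
    proof -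
      have i1: "integrable lborel (\<lambda>x. complex_of_real (v n x) * \<psi> x)"
        by (rule real_test_mult_test_function_integrable[OF v \<psi>])
      have i2: "integrable lborel (\<lambda>x. complex_of_real (v n x) * \<psi> 0)"
        using real_test_integrable[OF v[of n]] by simp
      have "(LINT x|lebesgue. complex_of_real (v n x) * \<psi> x) = (\<integral>x. complex_of_real (v n x) * \<psi> x \<partial>lborel)"
        by (rule integral_completion[OF borel_measurable_integrable[OF i1]])
      moreover have "(\<integral>x. complex_of_real (v n x) * \<psi> 0 \<partial>lborel) = \<psi> 0"
        by (simp add: one)
      ultimately have "(LINT x|lebesgue. complex_of_real (v n x) * \<psi> x) - \<psi> 0 =
          (\<integral>x. complex_of_real (v n x) * \<psi> x - complex_of_real (v n x) * \<psi> 0 \<partial>lborel)"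
        using i1 i2 by simp
      also have "norm \<dots> \<le> (\<integral>x. e / 2 * v n x \<partial>lborel)"
      proof (rule Bochner_Integration.integral_norm_bound_integral)
        show "integrable lborel (\<lambda>x. complex_of_real (v n x) * \<psi> x - complex_of_real (v n x) * \<psi> 0)"
          using i1 i2 by (rule Bochner_Integration.integrable_diff)
        show "integrable lborel (\<lambda>x. e / 2 * v n x)" using real_test_integrable[OF v[of n]] by simp
        show "norm (complex_of_real (v n x) * \<psi> x - complex_of_real (v n x) * \<psi> 0) \<le> e / 2 * v n x" for x
        proof (cases "x \<in> ball 0 (r n)")
          case True
          then have "norm (\<psi> x - \<psi> 0) \<le> e / 2"
            using d(2)[of x] N[OF n] by (auto simp: dist_norm)
          then show ?thesis
            unfolding right_diff_distrib[symmetric] norm_mult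
            using nonneg[of n x] mult_left_mono[of "norm (\<psi> x - \<psi> 0)" "e / 2" "v n x"]
            by (simp add: mult.commute)
        next
          case False
          then show ?thesis using real_test_eq_0[OF v False] by simp
        qed
      qed
      also have "\<dots> < e" using e by (simp add: one)
      finally show ?thesis .
    qed
    then show "\<exists>N. \<forall>n\<ge>N. norm ((LINT x|lebesgue. complex_of_real (v n x) * \<psi> x) - \<psi> 0) < e" by blast
  qed
qed

text \<open>The set where a continuous function differs from 0 is open, and a nonempty open set is
  not null. This allows division by the integral.\<close>

lemma real_test_integral_pos:
  fixes u :: "'a::euclidean_space \<Rightarrow> real"
  assumes u: "u \<in> real_test U" and nonneg: "\<And>x. 0 \<le> u x" and nz: "u a \<noteq> 0"
  shows "0 < (\<integral>x. u x \<partial>lborel)"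
proof (rule ccontr)
  assume "\<not> 0 < (\<integral>x. u x \<partial>lborel)"
  moreover have "0 \<le> (\<integral>x. u x \<partial>lborel)" using nonneg by (intro integral_nonneg_AE) auto
  ultimately have "(\<integral>x. u x \<partial>lborel) = 0" by simp
  then have "AE x in lborel. u x = 0"
    using integral_nonneg_eq_0_iff_AE[OF real_test_integrable[OF u]] nonneg by simp
  then have "AE x in lebesgue. u x = 0" by (rule AE_completion)
  moreover have o: "open {x. u x \<noteq> 0}"
    by (intro open_Collect_neq real_test_continuous[OF u] continuous_on_const)
  ultimately have "negligible {x. u x \<noteq> 0}"
    unfolding negligible_iff_null_sets using AE_iff_null_sets[of "{x. u x \<noteq> 0}" lebesgue] by simp
  then show False using o nz open_not_negligible by blast
qed

text \<open>The bound is homogeneous in u, so a violator may be divided by its integral. Moved to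
  the origin, the normalized violators have supports in balls of radius 1/(n+1), and the hypothesis
  applies to them.\<close>

lemma local_test_bound:
  fixes f :: "('a::euclidean_space \<Rightarrow> complex) \<Rightarrow> complex"
  assumes f: "distribution f"
    and H: "\<And>\<phi>. delta_sequence \<phi> \<Longrightarrow> (\<And>n. positive_fun (\<phi> n)) \<Longrightarrow> (\<And>n. normalized_fun (\<phi> n)) \<Longrightarrow>
      (\<lambda>n. translate x0 f (\<phi> n)) \<longlonglongrightarrow> \<gamma>"
    and e: "0 < e"
  obtains r where "r > 0" "\<And>u. u \<in> real_test (ball x0 r) \<Longrightarrow> (\<And>x. 0 \<le> u x) \<Longrightarrow>
      norm (f (\<lambda>x. of_real (u x)) - \<gamma> * of_real (\<integral>x. u x \<partial>lborel)) \<le> e * (\<integral>x. u x \<partial>lborel)"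
proof (rule ccontr)
  assume no: "\<not> thesis"
  have "\<exists>u\<in>real_test (ball x0 (inverse (real (Suc n)))). (\<forall>x. 0 \<le> u x) \<and>
      norm (f (\<lambda>x. of_real (u x)) - \<gamma> * of_real (\<integral>x. u x \<partial>lborel)) > e * (\<integral>x. u x \<partial>lborel)" for n
    using no that[of "inverse (real (Suc n))"] not_le by fastforce
  then obtain u where u: "\<And>n. u n \<in> real_test (ball x0 (inverse (real (Suc n))))" "\<And>n x. 0 \<le> u n x"
    "\<And>n. norm (f (\<lambda>x. of_real (u n x)) - \<gamma> * of_real (\<integral>x. u n x \<partial>lborel)) > e * (\<integral>x. u n x \<partial>lborel)"
    by metis
  define c where "c n = (\<integral>x. u n x \<partial>lborel)" for n
  \<comment> \<open>For the zero function both sides are equal, so the strict inequality excludes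
    it.\<close>
  have c: "c n > 0" for n
  proof -
    have "\<exists>a. u n a \<noteq> 0"
    proof (rule ccontr)
      assume "\<not> (\<exists>a. u n a \<noteq> 0)"
      then have z: "u n = (\<lambda>x. 0)" by auto
      have "f (\<lambda>x. of_real (u n x)) = 0" using distribution_scale[OF f u(1)[of n], of 0] by (simp add: z)
      moreover have "(\<integral>x. u n x \<partial>lborel) = 0" by (simp add: z)
      ultimately show False using u(3)[of n] by simp
    qed
    then show ?thesis unfolding c_def using real_test_integral_pos[OF u(1) u(2)] by blast
  qed
  define v where "v n x = 1 / c n * u n (x - (- x0))" for n x
  have v: "v n \<in> real_test (ball 0 (inverse (real (Suc n))))" for n
    using real_test_scale[OF real_test_translate[OF u(1)[of n], of "- x0"], of "1 / c n"]
    by (simp add: v_def[abs_def])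
  have v0: "0 \<le> v n x" for n x using c[of n] u(2) by (simp add: v_def)
  have v1: "(\<integral>x. v n x \<partial>lborel) = 1" for n
    using integral_lborel_translate[OF real_test_borel[OF u(1)[of n]], of "- x0"] c[of n]
    by (simp add: v_def c_def)
  have "(\<lambda>n. translate x0 f (\<lambda>x. complex_of_real (v n x))) \<longlonglongrightarrow> \<gamma>"
  proof (rule H)
    show "delta_sequence (\<lambda>n x. complex_of_real (v n x))"
      by (rule delta_sequenceI[OF v LIMSEQ_inverse_real_of_nat v0 v1])
    show "positive_fun (\<lambda>x. complex_of_real (v n x))" for n
      using v0 by (simp add: positive_fun_def)
    show "normalized_fun (\<lambda>x. complex_of_real (v n x))" for n
      using real_test_borel[OF v] v1 by (simp add: normalized_fun_def integral_completion)
  qed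
  moreover have "translate x0 f (\<lambda>x. complex_of_real (v n x)) = of_real (1 / c n) * f (\<lambda>x. of_real (u n x))" for n
    using distribution_scale[OF f u(1)[of n], of "1 / c n"] by (simp add: translate_def v_def)
  ultimately have "(\<lambda>n. of_real (1 / c n) * f (\<lambda>x. of_real (u n x))) \<longlonglongrightarrow> \<gamma>" by simp
  then obtain n where n: "norm (of_real (1 / c n) * f (\<lambda>x. of_real (u n x)) - \<gamma>) < e"
    using LIMSEQ_D[OF _ e] by blast
  \<comment> \<open>After division by the mass, the violation reads as a distance from \<gamma>
    greater than e. It holds for every n, so one index close to the limit is contradictory.\<close>
  have "of_real (1 / c n) * f (\<lambda>x. of_real (u n x)) - \<gamma> =
      of_real (1 / c n) * (f (\<lambda>x. of_real (u n x)) - \<gamma> * of_real (c n))"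
    using c[of n] by (simp add: field_simps)
  then have "norm (f (\<lambda>x. of_real (u n x)) - \<gamma> * of_real (c n)) / c n < e"
    using n c[of n] by (simp add: norm_mult norm_divide)
  then show False using u(3)[of n] c[of n] by (simp add: c_def[symmetric] field_simps)
qed

section \<open>Essential supremum on balls and the two implications\<close>

text \<open>Over a null set the essential supremum would be -\<infinity>; a ball of positive radius
  is not null, and this gives the lower bound 0.\<close>

lemma Linf_norm_bounds:
  fixes h :: "'a::euclidean_space \<Rightarrow> complex"
  assumes "r > 0" "h \<in> borel_measurable (lebesgue_on (ball a r))"
    "AE x in lebesgue_on (ball a r). norm (h x) \<le> M"
  shows "0 \<le> Linf_norm (ball a r) h" "Linf_norm (ball a r) h \<le> ereal M"
proof -
  have m: "(\<lambda>x. ereal (norm (h x))) \<in> borel_measurable (lebesgue_on (ball a r))"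
    using assms(2) by measurable
  have "emeasure (lebesgue_on (ball a r)) (space (lebesgue_on (ball a r))) \<noteq> 0"
  proof -
    have "\<not> negligible (ball a r)" using assms(1) open_not_negligible[of "ball a r"] by simp
    then show ?thesis
      by (simp add: emeasure_restrict_space negligible_iff_emeasure0)
  qed
  from esssup_const[OF this, of "0::ereal"] have "0 = esssup (lebesgue_on (ball a r)) (\<lambda>x. 0::ereal)" by simp
  also have "\<dots> \<le> Linf_norm (ball a r) h"
    unfolding Linf_norm_def by (rule esssup_mono) auto
  finally show "0 \<le> Linf_norm (ball a r) h" .
  show "Linf_norm (ball a r) h \<le> ereal M"
    unfolding Linf_norm_def using m assms(3) by (intro esssup_I) auto
qed

lemma AE_le_Linf_norm:
  assumes "Linf_norm B h \<le> ereal M"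
  shows "AE x in lebesgue_on B. norm (h x) \<le> M"
proof -
  have "AE x in lebesgue_on B. ereal (norm (h x)) \<le> Linf_norm B h"
    unfolding Linf_norm_def by (rule esssup_AE)
  then show ?thesis
  proof eventually_elim
    case (elim x)
    then show ?case using order_trans[OF elim assms] by simp
  qed
qed

lemma delta_limit_imp_restriction:
  fixes f :: "('a::euclidean_space \<Rightarrow> complex) \<Rightarrow> complex"
  assumes f: "distribution f"
    and H: "\<And>\<phi>. delta_sequence \<phi> \<Longrightarrow> (\<And>n. positive_fun (\<phi> n)) \<Longrightarrow> (\<And>n. normalized_fun (\<phi> n)) \<Longrightarrow>
      (\<lambda>n. translate x0 f (\<phi> n)) \<longlonglongrightarrow> \<gamma>"
  shows "\<exists>rs>0. restricts_to_Linf f (ball x0 rs)"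
    and "((\<lambda>r. Linf_norm (ball x0 r)
            (\<lambda>x. restriction f (ball x0 r) x - \<gamma> * indicator (ball x0 r) x)) \<longlongrightarrow> 0) (at_right 0)"
proof -
  \<comment> \<open>Condition (1) asks for some bound, so any fixed accuracy serves; 1 is a
    default.\<close>
  obtain rs where rs: "rs > 0" "\<And>u. u \<in> real_test (ball x0 rs) \<Longrightarrow> (\<And>x. 0 \<le> u x) \<Longrightarrow>
      norm (f (\<lambda>x. of_real (u x)) - \<gamma> * of_real (\<integral>x. u x \<partial>lborel)) \<le> 1 * (\<integral>x. u x \<partial>lborel)"
    using local_test_bound[OF f H zero_less_one] by metis
  have R: "restricts_to_Linf f (ball x0 rs)"
    by (rule restricts_to_LinfI[OF open_ball bounded_ball f zero_le_one rs(2)])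
  then show "\<exists>rs>0. restricts_to_Linf f (ball x0 rs)" using rs(1) by blast
  let ?h = "\<lambda>r x. restriction f (ball x0 r) x - \<gamma> * indicator (ball x0 r) x"
  have bounds: "\<exists>r0>0. \<forall>r. 0 < r \<and> r < r0 \<longrightarrow> 0 \<le> Linf_norm (ball x0 r) (?h r) \<and> Linf_norm (ball x0 r) (?h r) \<le> ereal (2 * e)"
    if e: "e > 0" for e
  proof -
    obtain r1 where r1: "r1 > 0" "\<And>u. u \<in> real_test (ball x0 r1) \<Longrightarrow> (\<And>x. 0 \<le> u x) \<Longrightarrow>
      norm (f (\<lambda>x. of_real (u x)) - \<gamma> * of_real (\<integral>x. u x \<partial>lborel)) \<le> e * (\<integral>x. u x \<partial>lborel)"
      using local_test_bound[OF f H e] by metis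
    \<comment> \<open>\<open>r1\<close> provides the accuracy e, while \<open>rs\<close> makes sure
      that \<open>restriction f (ball x0 r)\<close> is a representative and not an arbitrary
      function.\<close>
    have "0 \<le> Linf_norm (ball x0 r) (?h r) \<and> Linf_norm (ball x0 r) (?h r) \<le> ereal (2 * e)"
      if r: "0 < r" "r < min r1 rs" for r
    proof -
      have sub: "ball x0 r \<subseteq> ball x0 r1" "ball x0 r \<subseteq> ball x0 rs" using r by (auto intro: subset_ball)
      have "restricts_to_Linf f (ball x0 r)" by (rule restricts_to_Linf_subset[OF R sub(2)]) auto
      note w = restriction_works[OF this]
      have "AE x in lebesgue_on (ball x0 r). norm (restriction f (ball x0 r) x - \<gamma>) \<le> 2 * e"
        by (rule represented_bound_converse[OF open_ball bounded_ball w less_imp_le[OF e] r1(2)[OF real_test_mono[OF _ sub(1)]]])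
      then have "AE x in lebesgue_on (ball x0 r). norm (?h r x) \<le> 2 * e"
        by (simp add: AE_restrict_space_iff)
      moreover have "?h r \<in> borel_measurable (lebesgue_on (ball x0 r))"
        using w(1) by (intro borel_measurable_diff borel_measurable_times borel_measurable_const
            borel_measurable_indicator) (auto simp: Linf_iff sets_restrict_space_iff)
      ultimately show ?thesis using Linf_norm_bounds[OF r(1)] by blast
    qed
    then show ?thesis using r1(1) rs(1) by (intro exI[of _ "min r1 rs"]) auto
  qed
  show "((\<lambda>r. Linf_norm (ball x0 r) (?h r)) \<longlongrightarrow> 0) (at_right 0)"
  proof (rule order_tendstoI)
    fix a :: ereal assume "a < 0"
    moreover obtain r0 where "r0 > 0" "\<And>r. 0 < r \<Longrightarrow> r < r0 \<Longrightarrow> 0 \<le> Linf_norm (ball x0 r) (?h r)"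
      using bounds[OF zero_less_one] by blast
    ultimately show "eventually (\<lambda>r. a < Linf_norm (ball x0 r) (?h r)) (at_right 0)"
      unfolding eventually_at_right_field by (intro exI[of _ r0]) (auto intro: less_le_trans)
  next
    fix a :: ereal assume "0 < a"
    \<comment> \<open>A real b is interposed because \<open>a\<close> may be infinite; the accuracy
      b/2 compensates for the factor 2.\<close>
    then obtain b :: real where b: "0 < ereal b" "ereal b < a" using ereal_dense2 by blast
    then have "b / 2 > 0" by simp
    from bounds[OF this] obtain r0 where "r0 > 0" "\<And>r. 0 < r \<Longrightarrow> r < r0 \<Longrightarrow> Linf_norm (ball x0 r) (?h r) \<le> ereal b"
      by auto
    then show "eventually (\<lambda>r. Linf_norm (ball x0 r) (?h r) < a) (at_right 0)"
      unfolding eventually_at_right_field using b(2) by (intro exI[of _ r0]) (auto intro: le_less_trans)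
  qed
qed

text \<open>The supports of a delta sequence need not shrink, so each \<open>\<phi> n\<close> is cut
  by one fixed function \<open>\<rho>\<close>. The inner part, of mass \<open>m n\<close>, meets f
  where it is close to \<gamma>. The outer part, of mass \<open>1 - m n\<close>, meets f where it is
  merely bounded, and there the hypothesis on the supports enters.\<close>

lemma restriction_imp_delta_limit:
  fixes f :: "('a::euclidean_space \<Rightarrow> complex) \<Rightarrow> complex"
  assumes f: "distribution f" and rs: "rs > 0" and R: "restricts_to_Linf f (ball x0 rs)"
    and lim: "((\<lambda>r. Linf_norm (ball x0 r)
            (\<lambda>x. restriction f (ball x0 r) x - \<gamma> * indicator (ball x0 r) x)) \<longlongrightarrow> 0) (at_right 0)"
    and \<phi>: "delta_sequence \<phi>" "\<And>n. positive_fun (\<phi> n)" "\<And>n. normalized_fun (\<phi> n)"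
      "\<And>n. supp (\<phi> n) \<subseteq> ball 0 rs"
  shows "(\<lambda>n. translate x0 f (\<phi> n)) \<longlonglongrightarrow> \<gamma>"
proof (rule LIMSEQ_I)
  fix e :: real assume e: "0 < e"
  define \<epsilon> where "\<epsilon> = e / 2"
  have \<epsilon>: "\<epsilon> > 0" using e by (simp add: \<epsilon>_def)
  have "eventually (\<lambda>r. Linf_norm (ball x0 r)
      (\<lambda>x. restriction f (ball x0 r) x - \<gamma> * indicator (ball x0 r) x) < ereal \<epsilon>) (at_right 0)"
    using order_tendstoD(2)[OF lim, of "ereal \<epsilon>"] \<epsilon> by simp
  moreover have "eventually (\<lambda>r. r < rs) (at_right 0)" "eventually (\<lambda>r. 0 < r) (at_right (0::real))"
    using rs by (auto simp: eventually_at_right_field)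
  ultimately have "eventually (\<lambda>r. Linf_norm (ball x0 r)
      (\<lambda>x. restriction f (ball x0 r) x - \<gamma> * indicator (ball x0 r) x) < ereal \<epsilon> \<and> r < rs \<and> 0 < r) (at_right 0)"
    by eventually_elim auto
  then obtain r where r: "Linf_norm (ball x0 r)
      (\<lambda>x. restriction f (ball x0 r) x - \<gamma> * indicator (ball x0 r) x) < ereal \<epsilon>" "r < rs" "0 < r"
    using eventually_happens'[OF trivial_limit_at_right_real] by blast
  have sub: "ball x0 r \<subseteq> ball x0 rs" using r(2) by (auto intro: subset_ball)
  have "restricts_to_Linf f (ball x0 r)" by (rule restricts_to_Linf_subset[OF R sub]) auto
  note w = restriction_works[OF this]
  have "AE x in lebesgue_on (ball x0 r). norm (restriction f (ball x0 r) x - \<gamma> * indicator (ball x0 r) x) \<le> \<epsilon>"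
    by (rule AE_le_Linf_norm[OF less_imp_le[OF r(1)]])
  then have near: "AE x in lebesgue_on (ball x0 r). norm (restriction f (ball x0 r) x - \<gamma>) \<le> \<epsilon>"
    by (simp add: AE_restrict_space_iff)
  have near_bound: "norm (f (\<lambda>x. of_real (u x)) - \<gamma> * of_real (\<integral>x. u x \<partial>lborel)) \<le> \<epsilon> * (\<integral>x. u x \<partial>lborel)"
    if "u \<in> real_test (ball x0 r)" "\<And>x. 0 \<le> u x" for u
    using w(1) by (intro represented_diff_bound[OF _ _ near w(2) that less_imp_le[OF \<epsilon>]]) (auto simp: Linf_iff)
  obtain g where g: "g \<in> Linf (ball x0 rs)" "represents_on g f (ball x0 rs)"
    using R by (auto simp: restricts_to_Linf_def)
  obtain M where M: "0 \<le> M" "AE x in lebesgue_on (ball x0 rs). norm (g x) \<le> M" using LinfE[OF g(1)] .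
  \<comment> \<open>The estimate for f - c with c = 0: on the large ball the size of f matters, not
    its distance from \<gamma>.\<close>
  have far_bound: "norm (f (\<lambda>x. of_real (u x))) \<le> M * (\<integral>x. u x \<partial>lborel)"
    if "u \<in> real_test (ball x0 rs)" "\<And>x. 0 \<le> u x" for u
    using represented_diff_bound[of "ball x0 rs" g 0 M, OF _ _ _ g(2) that M(1)] g(1) M(2)
    by (simp add: Linf_iff)
  obtain \<rho> where \<rho>: "\<rho> \<in> real_test (ball 0 r)" "\<And>x. 0 \<le> \<rho> x" "\<And>x. \<rho> x \<le> 1" "\<rho> (0::'a) = 1"
    using smooth_urysohn[of "{0}" "ball 0 r"] r(3) by auto
  define m where "m n = (\<integral>x. \<rho> x * Re (\<phi> n x) \<partial>lborel)" for n
  have \<phi>t: "\<phi> n \<in> test_functions" for n using \<phi>(1) by (simp add: delta_sequence_def)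
  have \<phi>r: "\<phi> n x = of_real (Re (\<phi> n x))" and \<phi>0: "0 \<le> Re (\<phi> n x)" for n x
    using \<phi>(2)[of n] by (auto simp: positive_fun_def complex_nonneg_Reals_iff complex_eq_iff)
  \<comment> \<open>\<open>\<rho>\<close> is itself a test function, so the delta property sends the
    inner mass to its value 1 at the origin.\<close>
  have mlim: "(\<lambda>n. 1 - m n) \<longlonglongrightarrow> 0"
  proof -
    have "(LINT x|lebesgue. \<phi> n x * of_real (\<rho> x)) = of_real (m n)" for n
    proof -
      have i: "integrable lborel (\<lambda>x. complex_of_real (\<rho> x) * \<phi> n x)"
        by (rule real_test_mult_test_function_integrable[OF \<rho>(1) \<phi>t])
      have "(LINT x|lebesgue. \<phi> n x * of_real (\<rho> x)) = (LINT x|lebesgue. of_real (\<rho> x) * \<phi> n x)"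
        by (simp add: mult.commute)
      also have "\<dots> = (\<integral>x. of_real (\<rho> x) * \<phi> n x \<partial>lborel)"
        by (rule integral_completion[OF borel_measurable_integrable[OF i]])
      also have "\<dots> = (\<integral>x. complex_of_real (\<rho> x * Re (\<phi> n x)) \<partial>lborel)"
        by (rule Bochner_Integration.integral_cong) (use \<phi>r in auto)
      also have "\<dots> = of_real (m n)" unfolding m_def by (rule integral_complex_of_real)
      finally show ?thesis .
    qed
    moreover have "\<forall>\<psi>\<in>test_functions. (\<lambda>n. LINT x|lebesgue. \<phi> n x * \<psi> x) \<longlonglongrightarrow> \<psi> 0"
      using \<phi>(1) by (simp add: delta_sequence_def)
    from bspec[OF this real_test_of_real(1)[OF \<rho>(1)]]
    have "(\<lambda>n. LINT x|lebesgue. \<phi> n x * of_real (\<rho> x)) \<longlonglongrightarrow> of_real (\<rho> 0)" .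
    ultimately have "(\<lambda>n. complex_of_real (m n)) \<longlonglongrightarrow> of_real 1" using \<rho>(4) by simp
    then have "m \<longlonglongrightarrow> 1" by (simp only: tendsto_of_real_iff)
    from tendsto_diff[OF tendsto_const[of 1] this] show ?thesis by simp
  qed
  have "norm (translate x0 f (\<phi> n) - \<gamma>) \<le> \<epsilon> + (M + norm \<gamma>) * (1 - m n)" for n
  proof -
    define u where "u x = Re (\<phi> n (x - x0))" for x
    define v where "v x = \<rho> (x - x0) * u x" for x
    have Re\<phi>: "(\<lambda>x. Re (\<phi> n x)) \<in> real_test (ball 0 rs)" by (rule test_function_parts[OF \<phi>t \<phi>(4)])
    have u: "u \<in> real_test (ball x0 rs)"
      using real_test_translate[OF Re\<phi>, of x0] by (simp add: u_def[abs_def])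
    have \<rho>t: "(\<lambda>x. \<rho> (x - x0)) \<in> real_test (ball x0 r)"
      using real_test_translate[OF \<rho>(1), of x0] by simp
    have "(\<lambda>x. u x * \<rho> (x - x0)) \<in> real_test (ball x0 r)"
      by (rule real_test_mult[OF \<rho>t real_test_Ck[OF u]])
    then have v: "v \<in> real_test (ball x0 r)" by (simp add: v_def[abs_def] mult.commute)
    have v': "v \<in> real_test (ball x0 rs)" by (rule real_test_mono[OF v sub])
    have uv: "(\<lambda>x. u x - v x) \<in> real_test (ball x0 rs)" by (rule real_test_diff[OF u v'])
    have u0: "0 \<le> u x" for x using \<phi>0 by (simp add: u_def)
    have v0: "0 \<le> v x" for x using u0 \<rho>(2) by (simp add: v_def)
    have uv0: "0 \<le> u x - v x" for x
      using mult_right_mono[OF \<rho>(3)[of "x - x0"] u0[of x]] by (simp add: v_def)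
    have "of_real (\<integral>x. Re (\<phi> n x) \<partial>lborel) = (LINT x|lebesgue. \<phi> n x)"
    proof -
      have "(LINT x|lebesgue. \<phi> n x) = (\<integral>x. \<phi> n x \<partial>lborel)"
        by (rule integral_completion[OF borel_measurable_integrable[OF test_function_integrable[OF \<phi>t]]])
      also have "\<dots> = (\<integral>x. complex_of_real (Re (\<phi> n x)) \<partial>lborel)"
        by (rule Bochner_Integration.integral_cong) (use \<phi>r in auto)
      finally show ?thesis by simp
    qed
    then have "complex_of_real (\<integral>x. Re (\<phi> n x) \<partial>lborel) = of_real 1"
      using \<phi>(3)[of n] by (simp add: normalized_fun_def)
    then have Re1: "(\<integral>x. Re (\<phi> n x) \<partial>lborel) = 1" by (simp only: of_real_eq_iff)
    have u1: "(\<integral>x. u x \<partial>lborel) = 1"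
      using integral_lborel_translate[OF real_test_borel[OF Re\<phi>], of x0] Re1 by (simp add: u_def)
    have "(\<lambda>x. \<rho> x * Re (\<phi> n x)) \<in> borel_measurable borel"
      using real_test_borel[OF \<rho>(1)] real_test_borel[OF Re\<phi>] by (rule borel_measurable_times)
    from integral_lborel_translate[OF this, of x0]
    have v1: "(\<integral>x. v x \<partial>lborel) = m n" by (simp add: v_def u_def m_def)
    have uv1: "(\<integral>x. u x - v x \<partial>lborel) = 1 - m n"
      using real_test_integrable[OF u] real_test_integrable[OF v] u1 v1 by simp
    have "0 \<le> (\<integral>x. u x - v x \<partial>lborel)"
      using uv0 by (intro integral_nonneg_AE) auto
    then have m1: "m n \<le> 1" by (simp add: uv1)
    have "translate x0 f (\<phi> n) = f (\<lambda>x. of_real (v x + (u x - v x)))"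
      unfolding translate_def u_def by (simp flip: \<phi>r)
    also have "\<dots> = f (\<lambda>x. of_real (v x)) + f (\<lambda>x. of_real (u x - v x))"
      by (rule distribution_add[OF f v' uv])
    \<comment> \<open>The constant is split as \<gamma> times \<open>m n\<close> plus \<gamma> times
      \<open>1 - m n\<close>, in proportion to the masses of the two parts.\<close>
    finally have "translate x0 f (\<phi> n) - \<gamma> =
        (f (\<lambda>x. of_real (v x)) - \<gamma> * of_real (m n)) + (f (\<lambda>x. of_real (u x - v x)) - \<gamma> * of_real (1 - m n))"
      by (simp add: algebra_simps)
    also have "norm \<dots> \<le> norm (f (\<lambda>x. of_real (v x)) - \<gamma> * of_real (m n)) +
        (norm (f (\<lambda>x. of_real (u x - v x))) + norm (\<gamma> * of_real (1 - m n)))"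
      by (intro norm_triangle_le add_left_mono norm_triangle_ineq4)
    also have "\<dots> \<le> \<epsilon> * m n + (M * (1 - m n) + norm \<gamma> * (1 - m n))"
    proof (intro add_mono)
      show "norm (f (\<lambda>x. of_real (v x)) - \<gamma> * of_real (m n)) \<le> \<epsilon> * m n"
        using near_bound[OF v v0] by (simp add: v1)
      show "norm (f (\<lambda>x. of_real (u x - v x))) \<le> M * (1 - m n)"
        using far_bound[OF uv uv0] by (simp only: uv1)
      show "norm (\<gamma> * of_real (1 - m n)) \<le> norm \<gamma> * (1 - m n)"
        using m1 by (simp add: norm_mult del: of_real_diff)
    qed
    also have "\<dots> \<le> \<epsilon> + (M + norm \<gamma>) * (1 - m n)"
      using mult_left_mono[OF m1 less_imp_le[OF \<epsilon>]] by (simp add: algebra_simps)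
    finally show ?thesis .
  qed
  moreover have "(\<lambda>n. \<epsilon> + (M + norm \<gamma>) * (1 - m n)) \<longlonglongrightarrow> \<epsilon> + (M + norm \<gamma>) * 0"
    by (intro tendsto_intros mlim)
  then have "eventually (\<lambda>n. \<epsilon> + (M + norm \<gamma>) * (1 - m n) < e) sequentially"
    by (rule order_tendstoD) (use e in \<open>simp add: \<epsilon>_def\<close>)
  ultimately show "\<exists>N. \<forall>n\<ge>N. norm (translate x0 f (\<phi> n) - \<gamma>) < e"
    unfolding eventually_sequentially by (meson le_less_trans)
qed

theorem proposition7p11:
  fixes f :: "(real ^ 'd \<Rightarrow> complex) \<Rightarrow> complex"
    and x0 :: "real ^ 'd"
    and \<gamma> :: complex
  assumes "distribution f"
  shows
    "((\<forall>\<phi>. delta_sequence \<phi> \<and> (\<forall>n. positive_fun (\<phi> n) \<and> normalized_fun (\<phi> n))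
        \<longrightarrow> (\<lambda>n. translate x0 f (\<phi> n)) \<longlonglongrightarrow> \<gamma>)
      \<longrightarrow> (\<exists>rs>0. restricts_to_Linf f (ball x0 rs)) \<and>
          ((\<lambda>r. Linf_norm (ball x0 r)
                  (\<lambda>x. restriction f (ball x0 r) x - \<gamma> * indicator (ball x0 r) x))
             \<longlongrightarrow> 0) (at_right 0))
     \<and>
     (\<forall>rs>0. restricts_to_Linf f (ball x0 rs) \<and>
          ((\<lambda>r. Linf_norm (ball x0 r)
                  (\<lambda>x. restriction f (ball x0 r) x - \<gamma> * indicator (ball x0 r) x))
             \<longlongrightarrow> 0) (at_right 0)
      \<longrightarrow> (\<forall>\<phi>. delta_sequence \<phi> \<and>
               (\<forall>n. positive_fun (\<phi> n) \<and> normalized_fun (\<phi> n) \<and> supp (\<phi> n) \<subseteq> ball 0 rs)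
             \<longrightarrow> (\<lambda>n. translate x0 f (\<phi> n)) \<longlonglongrightarrow> \<gamma>))"
proof (intro conjI impI allI)
  assume H: "\<forall>\<phi>. delta_sequence \<phi> \<and> (\<forall>n. positive_fun (\<phi> n) \<and> normalized_fun (\<phi> n))
        \<longrightarrow> (\<lambda>n. translate x0 f (\<phi> n)) \<longlonglongrightarrow> \<gamma>"
  show "\<exists>rs>0. restricts_to_Linf f (ball x0 rs)"
    by (rule delta_limit_imp_restriction(1)[OF assms]) (use H in blast)
  show "((\<lambda>r. Linf_norm (ball x0 r)
      (\<lambda>x. restriction f (ball x0 r) x - \<gamma> * indicator (ball x0 r) x)) \<longlongrightarrow> 0) (at_right 0)"
    by (rule delta_limit_imp_restriction(2)[OF assms]) (use H in blast)
next
  fix rs and \<phi> :: "nat \<Rightarrow> real ^ 'd \<Rightarrow> complex"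
  assume "0 < rs"
    and "restricts_to_Linf f (ball x0 rs) \<and>
      ((\<lambda>r. Linf_norm (ball x0 r)
        (\<lambda>x. restriction f (ball x0 r) x - \<gamma> * indicator (ball x0 r) x)) \<longlongrightarrow> 0) (at_right 0)"
    and "delta_sequence \<phi> \<and>
      (\<forall>n. positive_fun (\<phi> n) \<and> normalized_fun (\<phi> n) \<and> supp (\<phi> n) \<subseteq> ball 0 rs)"
  then show "(\<lambda>n. translate x0 f (\<phi> n)) \<longlonglongrightarrow> \<gamma>"
    by (intro restriction_imp_delta_limit[OF assms]) auto
qed

end
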